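(* Let $u$ be a semiconcave viscosity solution of $H(x,Du(x))=0$ in $\Omega\subset\mathbb{R}^2$, and let $x_0\in\mathrm{Sing}(u)$ be such that $0\notin H_p(x_0,D^+u(x_0))$. Let $\mathbf{x}_j:[0,T]\to\Omega$ ($j=1,2$) be strict singular characteristics with initial point $x_0$. Then there exists $\tau\in(0,T]$ such that $\mathbf{x}_1(t)=\mathbf{x}_2(t)$ for all $t\in[0,\tau]$.
   Context: Setting: $\Omega\subset\mathbb{R}^2$ is a bounded domain and $H:\Omega\times\mathbb{R}^2\to\mathbb{R}$, $(x,p)\mapsto H(x,p)$, is of class $C^1$ and strictly convex in $p$; $H_p$ denotes the gradient in $p$, and $H_p(x,A)=\{H_p(x,p):p\in A\}$ for a set $A$. Solutions of $H(x,Du(x))=0$ in $\Omega$ are understood in the viscosity sense. A function $u:\Omega\to\mathbb{R}$ is semiconcave (with linear modulus) if there is $C>0$ with $\lambda u(x)+(1-\lambda)u(y)-u(\lambda x+(1-\lambda)y)\le \frac C2\lambda(1-\lambda)|x-y|^2$ for all $\lambda\in[0,1]$ and all $x,y\in\Omega$ such that the segment joining $x$ and $y$ lies in $\Omega$. The superdifferential is $D^+u(x)=\{p:\limsup_{y\to x}\frac{u(y)-u(x)-\langle p,y-x\rangle}{|y-x|}\le 0\}$; for semiconcave $u$ it is a nonempty compact convex set. $\mathrm{Sing}(u)$ is the set of $x\in\Omega$ such that $D^+u(x)$ is not a singleton. A strict singular characteristic with initial point $x_0\in\mathrm{Sing}(u)$ is a Lipschitz curve $\mathbf{x}:[0,T]\to\Omega$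 ($T>0$) with $\mathbf{x}(t)\in\mathrm{Sing}(u)$ for all $t\in[0,T]$ and $\mathbf{x}(0)=x_0$, for which there exists a measurable selection $p(t)\in D^+u(\mathbf{x}(t))$ such that $\dot{\mathbf{x}}(t)=H_p(\mathbf{x}(t),p(t))$ for a.e. $t\in[0,T]$. *)

theory Defs
  imports "HOL-Analysis.Analysis"
begin

definition C1_on :: "'a::real_inner set \<Rightarrow> ('a \<Rightarrow> real) \<Rightarrow> bool" where
  "C1_on S f \<longleftrightarrow> (\<exists>g. continuous_on S g \<and> (\<forall>z\<in>S. GDERIV f z :> g z))"

definition strictly_convex_on :: "'a::real_vector set \<Rightarrow> ('a \<Rightarrow> real) \<Rightarrow> bool" where
  "strictly_convex_on S f \<longleftrightarrow> convex S \<and>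
     (\<forall>p\<in>S. \<forall>q\<in>S. \<forall>c. p \<noteq> q \<and> 0 < c \<and> c < 1 \<longrightarrow>
        f (c *\<^sub>R p + (1 - c) *\<^sub>R q) < c * f p + (1 - c) * f q)"

definition grad :: "('a::real_inner \<Rightarrow> real) \<Rightarrow> 'a \<Rightarrow> 'a" where
  "grad f p = (THE d. GDERIV f p :> d)"

abbreviation H_p :: "('a::real_inner \<Rightarrow> 'a \<Rightarrow> real) \<Rightarrow> 'a \<Rightarrow> 'a \<Rightarrow> 'a" where
  "H_p H x p \<equiv> grad (H x) p"

definition semiconcave_on :: "'a::euclidean_space set \<Rightarrow> ('a \<Rightarrow> real) \<Rightarrow> bool" where
  "semiconcave_on \<Omega> u \<longleftrightarrow> (\<exists>C>0. \<forall>c\<in>{0..1}. \<forall>x\<in>\<Omega>. \<forall>y\<in>\<Omega>. closed_segment x y \<subseteq> \<Omega> \<longrightarrow>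
     c * u x + (1 - c) * u y - u (c *\<^sub>R x + (1 - c) *\<^sub>R y)
       \<le> C / 2 * c * (1 - c) * (norm (x - y))\<^sup>2)"

text \<open>The limits are taken within \<open>\<Omega>\<close>, because \<open>u\<close> is a total function here and
  only its values on \<open>\<Omega>\<close> are meaningful.\<close>

definition superdiff :: "'a::euclidean_space set \<Rightarrow> ('a \<Rightarrow> real) \<Rightarrow> 'a \<Rightarrow> 'a set" where
  "superdiff \<Omega> u x =
     {p. Limsup (at x within \<Omega>) (\<lambda>y. ereal ((u y - u x - p \<bullet> (y - x)) / norm (y - x))) \<le> 0}"

definition subdiff :: "'a::euclidean_space set \<Rightarrow> ('a \<Rightarrow> real) \<Rightarrow> 'a \<Rightarrow> 'a set" where
  "subdiff \<Omega> u x =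
     {p. Liminf (at x within \<Omega>) (\<lambda>y. ereal ((u y - u x - p \<bullet> (y - x)) / norm (y - x))) \<ge> 0}"

definition Sing :: "'a::euclidean_space set \<Rightarrow> ('a \<Rightarrow> real) \<Rightarrow> 'a set" where
  "Sing \<Omega> u = {x\<in>\<Omega>. \<not> is_singleton (superdiff \<Omega> u x)}"

text \<open>Continuous viscosity solutions of \<open>H(x, Du) = 0\<close>, in the definition by semidifferentials
  (Crandall--Lions; Cannarsa--Sinestrari).\<close>

definition viscosity_solution ::
    "'a::euclidean_space set \<Rightarrow> ('a \<Rightarrow> 'a \<Rightarrow> real) \<Rightarrow> ('a \<Rightarrow> real) \<Rightarrow> bool" where
  "viscosity_solution \<Omega> H u \<longleftrightarrow> continuous_on \<Omega> u \<and>
     (\<forall>x\<in>\<Omega>. \<forall>p\<in>superdiff \<Omega> u x. H x p \<le> 0) \<and>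
     (\<forall>x\<in>\<Omega>. \<forall>p\<in>subdiff \<Omega> u x. H x p \<ge> 0)"

definition strict_singular_characteristic ::
    "'a::euclidean_space set \<Rightarrow> ('a \<Rightarrow> 'a \<Rightarrow> real) \<Rightarrow> ('a \<Rightarrow> real) \<Rightarrow> 'a \<Rightarrow> real \<Rightarrow> (real \<Rightarrow> 'a) \<Rightarrow> bool"
  where
  "strict_singular_characteristic \<Omega> H u x\<^sub>0 T \<xi> \<longleftrightarrow>
     T > 0 \<and> x\<^sub>0 \<in> Sing \<Omega> u \<and>
     (\<exists>L. L-lipschitz_on {0..T} \<xi>) \<and>
     (\<forall>t\<in>{0..T}. \<xi> t \<in> Sing \<Omega> u) \<and>
     \<xi> 0 = x\<^sub>0 \<and>
     (\<exists>p \<in> borel_measurable (lebesgue_on {0..T}).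
        (\<forall>t\<in>{0..T}. p t \<in> superdiff \<Omega> u (\<xi> t)) \<and>
        (AE t in lebesgue_on {0..T}.
           (\<xi> has_vector_derivative H_p H (\<xi> t) (p t)) (at t within {0..T})))"

end

theory Submission
  imports Defs
begin

text \<open>Write \<open>D x\<close> for the superdifferential, \<open>m x\<close> for the minimizer of the strictly convex function
  \<open>H x\<close> on \<open>D x\<close>, and \<open>V x = H_p H x (m x)\<close>. Along a characteristic \<open>\<xi>\<close> the function
  \<open>u (\<xi> t) - m (\<xi> t0) \<bullet> \<xi> t\<close> grows at least like the integral of the excess
  \<open>H (\<xi> s) (p s) - H (\<xi> s) (m (\<xi> t0))\<close>, but by semiconcavity at most quadratically from \<open>t0\<close> on. So
  the momenta \<open>p s\<close> concentrate at \<open>m (\<xi> t0)\<close>, and \<open>\<xi>\<close> has the right derivative \<open>V (\<xi> t0)\<close> at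
  \<^emph>\<open>every\<close> \<open>t0\<close>.

  Let \<open>v0 = V x0 \<noteq> 0\<close> and \<open>n \<bottom> v0\<close>. For small \<open>t > 0\<close> the set \<open>D (\<xi> t)\<close> is almost contained in the
  line \<open>m x0 + \<real> n\<close>; it comes close to \<open>m x0\<close>, where \<open>H < 0\<close>, while its extreme points in the
  directions \<open>n\<close> and \<open>- n\<close> are limits of gradients and satisfy \<open>H = 0\<close>. So it extends by a fixed
  amount to both sides of \<open>m x0\<close>. Two nearby points with this property whose difference is
  orthogonal to \<open>v0\<close> coincide, because the superdifferential is almost monotone. Hence both
  characteristics run on one graph over the direction \<open>v0\<close>, with the same right derivative
  wherever they meet, and the increasing heights \<open>\<xi> t \<bullet> v0\<close> agree.\<close>

section \<open>Monotonicity from one-sided increments\<close>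

text \<open>The minimizer map is in general discontinuous, so no Gronwall estimate applies to
  \<open>velocity\<close>, and an almost-everywhere equation with a free selection \<open>p\<close>
  does not say that two curves through one point move alike. The right derivative at every time
  repairs this: the speed becomes a function of the position, and uniqueness becomes a comparison of
  heights in one real variable. Derivatives are obtained on the right because the quadratic bound
  starts at \<open>t0\<close>; the lower estimate uses increments that end at the current time
  \<open>s\<close>, where \<open>p s\<close> bounds earlier values of \<open>u\<close> from above.
  Upper semicontinuity alone puts \<open>D (\<xi> t)\<close> near \<open>D x0\<close>, not near
  \<open>p0\<close>; that the momenta keep coming close to \<open>p0\<close> has to be carried
  forward from each time to slightly later ones. Integrals of rates are replaced throughout by
  monotonicity lemmas with Dini-type hypotheses.\<close>

lemma continuous_le_from_left_steps:
  fixes F :: "real \<Rightarrow> real"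
  assumes "a \<le> b" and cont: "continuous_on {a..b} F"
    and step: "\<And>s. s \<in> {a<..b} \<Longrightarrow> \<exists>h>0. a \<le> s - h \<and> F (s - h) \<le> F s"
  shows "F a \<le> F b"
proof -
  \<comment> \<open>Backward steps from \<open>b\<close> may accumulate before they reach
    \<open>a\<close>; continuity closes this gap, since the set is closed and so contains its
    infimum.\<close>
  define S where "S = {s \<in> {a..b}. F s \<le> F b}"
  have "closed S"
    unfolding S_def using continuous_on_closed_Collect_le[OF cont continuous_on_const closed_atLeastAtMost]
    by simp
  have bS: "b \<in> S" using \<open>a \<le> b\<close> by (simp add: S_def)
  have bdd: "bdd_below S" by (rule bdd_belowI[of _ a]) (simp add: S_def)
  have inf: "Inf S \<in> S"
    using closed_contains_Inf[OF _ bdd \<open>closed S\<close>] bS by blast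
  have "Inf S = a"
  proof (rule ccontr)
    assume "Inf S \<noteq> a"
    with inf have "Inf S \<in> {a<..b}" by (auto simp: S_def)
    then obtain h where h: "h > 0" "a \<le> Inf S - h" "F (Inf S - h) \<le> F (Inf S)"
      using step by blast
    then have "Inf S - h \<in> S" using inf by (auto simp: S_def)
    then have "Inf S \<le> Inf S - h" using bdd by (rule cInf_lower)
    with h show False by simp
  qed
  with inf show ?thesis by (simp add: S_def)
qed

lemma continuous_le_from_right_steps:
  fixes F :: "real \<Rightarrow> real"
  assumes "a \<le> b" and cont: "continuous_on {a..b} F"
    and step: "\<And>s. s \<in> {a..<b} \<Longrightarrow> \<exists>h>0. s + h \<le> b \<and> F s \<le> F (s + h)"
  shows "F a \<le> F b"
proof -
  have "- F (- (- b)) \<le> - F (- (- a))"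
  proof (rule continuous_le_from_left_steps[of "-b" "-a" "\<lambda>s. - F (- s)"])
    show "continuous_on {-b..-a} (\<lambda>s. - F (- s))"
      by (intro continuous_intros continuous_on_compose2[OF cont]) auto
    fix s assume "s \<in> {-b<..-a}"
    then obtain h where "h > 0" "- s + h \<le> b" "F (-s) \<le> F (-s + h)"
      using step[of "-s"] by auto
    then show "\<exists>h>0. -b \<le> s - h \<and> - F (- (s - h)) \<le> - F (- s)"
      by (intro exI[of _ h]) (auto simp: algebra_simps)
  qed (use assms in auto)
  then show ?thesis by simp
qed

text \<open>The exceptional null set is enclosed in an open set of small measure, and the measure of
  its part to the left of \<open>s\<close> is added as a corrector that absorbs the possible decrease there.\<close>

lemma nondecreasing_from_left_Dini_ae:
  fixes f :: "real \<Rightarrow> real"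
  assumes "a \<le> b" and cont: "continuous_on {a..b} f"
    and N: "N \<in> null_sets lebesgue"
    and L: "\<And>r s. \<lbrakk>a \<le> r; r \<le> s; s \<le> b\<rbrakk> \<Longrightarrow> f s - f r \<ge> - L * (s - r)"
    and dini: "\<And>s e. \<lbrakk>s \<in> {a<..b} - N; e > 0\<rbrakk> \<Longrightarrow> \<exists>h>0. a \<le> s - h \<and> f s - f (s - h) \<ge> - e * h"
  shows "f a \<le> f b"
proof (rule field_le_epsilon)
  fix e0 :: real assume "e0 > 0"
  \<comment> \<open>The total loss is at most \<open>e * (b - a)\<close> from the Dini slack and
    \<open>\<bar>L\<bar> * e\<close> from the corrector; the extra 1 keeps the denominator
    positive.\<close>
  define e where "e = e0 / (b - a + \<bar>L\<bar> + 1)"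
  have den: "b - a + \<bar>L\<bar> + 1 > 0" using \<open>a \<le> b\<close> by simp
  have "e > 0" unfolding e_def using den \<open>e0 > 0\<close> by simp
  obtain U where U: "open U" "N \<subseteq> U" "U - N \<in> lmeasurable" "emeasure lebesgue (U - N) < ennreal e"
    using sets_lebesgue_outer_open[of N e] N \<open>e > 0\<close> by (metis null_setsD2)
  have Uset: "U \<in> sets lebesgue" using U(1) by simp
  have mU: "emeasure lebesgue U < ennreal e"
    using U(4) emeasure_Diff_null_set[OF N Uset] by simp
  define m where "m s = measure lebesgue (U \<inter> {a..s})" for s
  have lm: "U \<inter> A \<in> lmeasurable" if "A \<in> lmeasurable" for A
    using that Uset by (simp add: fmeasurable_Int_fmeasurable inf_commute)
  have msplit: "m s = m r + measure lebesgue (U \<inter> {r<..s})" if "a \<le> r" "r \<le> s" for r s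
  proof -
    have "U \<inter> {a..s} = (U \<inter> {a..r}) \<union> (U \<inter> {r<..s})" using that by auto
    moreover have "{r<..s} \<in> lmeasurable" by (rule fmeasurableI2[of "{r..s}"]) auto
    moreover have "U \<inter> {a..s} \<in> lmeasurable" "U \<inter> {a..r} \<in> lmeasurable"
      by (auto intro!: lm)
    moreover have "U \<inter> {r<..s} \<in> lmeasurable" by (rule lm) fact
    moreover have "(U \<inter> {a..r}) \<inter> (U \<inter> {r<..s}) = {}" by auto
    ultimately show ?thesis unfolding m_def
      by (metis measure_Un3 measure_empty diff_zero)
  qed
  have mle: "m s - m r \<le> s - r" "m s - m r \<ge> 0" if "a \<le> r" "r \<le> s" for r s
  proof -
    have "measure lebesgue (U \<inter> {r<..s}) \<le> measure lebesgue {r<..s}"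
      using Uset by (intro measure_mono_fmeasurable) (auto intro: fmeasurableI2[of "{r..s}"])
    then show "m s - m r \<le> s - r" using msplit[OF that] that by simp
    show "m s - m r \<ge> 0" using msplit[OF that] by simp
  qed
  have mlip: "1-lipschitz_on {a..b} m"
  proof (rule lipschitz_onI)
    fix x y assume "x \<in> {a..b}" "y \<in> {a..b}"
    then show "dist (m x) (m y) \<le> 1 * dist x y"
      using mle[of x y] mle[of y x] by (cases "x \<le> y") (auto simp: dist_real_def)
  qed simp
  have mb: "m b \<le> e"
  proof -
    have "emeasure lebesgue (U \<inter> {a..b}) \<le> emeasure lebesgue U"
      using Uset by (intro emeasure_mono) auto
    then have "emeasure lebesgue (U \<inter> {a..b}) \<le> ennreal e" using mU by auto
    then show ?thesis unfolding m_def measure_def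
      using \<open>e > 0\<close> by (metis enn2real_mono enn2real_ennreal ennreal_less_top less_eq_real_def)
  qed
  have ma: "m a \<ge> 0" by (simp add: m_def)
  define F where "F s = f s + e * s + \<bar>L\<bar> * m s" for s
  have "F a \<le> F b"
  proof (rule continuous_le_from_left_steps[OF \<open>a \<le> b\<close>])
    show "continuous_on {a..b} F" unfolding F_def
      by (intro continuous_intros cont lipschitz_on_continuous_on[OF mlip])
    fix s assume s: "s \<in> {a<..b}"
    show "\<exists>h>0. a \<le> s - h \<and> F (s - h) \<le> F s"
    proof (cases "s \<in> N")
      case False
      then obtain h where h: "h > 0" "a \<le> s - h" "f s - f (s - h) \<ge> - e * h"
        using dini[of s e] s \<open>e > 0\<close> by auto
      have "\<bar>L\<bar> * m (s - h) \<le> \<bar>L\<bar> * m s"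
        using mle(2)[of "s-h" s] h by (intro mult_left_mono) auto
      then have "F (s - h) \<le> F s" using h by (simp add: F_def algebra_simps)
      then show ?thesis using h by blast
    next
      case True
      then have "s \<in> U" using U by auto
      then obtain d where d: "d > 0" "\<And>y. dist y s < d \<Longrightarrow> y \<in> U"
        using U(1) unfolding open_dist by blast
      define h where "h = min (d/2) (s - a)"
      have h: "h > 0" "a \<le> s - h" "h < d" using d s by (auto simp: h_def)
      have "{s-h<..s} \<subseteq> U"
        using h by (auto intro!: d(2) simp: dist_real_def)
      then have "U \<inter> {s-h<..s} = {s-h<..s}" by auto
      \<comment> \<open>On an interval inside \<open>U\<close> the corrector has slope one, so
        \<open>\<bar>L\<bar> * m\<close> gains at least what \<open>f\<close> can lose
        there.\<close>
      then have ms: "m s = m (s-h) + h" using msplit[of "s-h" s] h by simp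
      have "f s - f (s-h) \<ge> - L * h" using L[of "s-h" s] h s by auto
      moreover have "L * h \<le> \<bar>L\<bar> * h" using h by (intro mult_right_mono) auto
      moreover have "e * h \<ge> 0" using h \<open>e > 0\<close> by simp
      ultimately have "F (s - h) \<le> F s"
        unfolding F_def ms by (simp add: algebra_simps)
      then show ?thesis using h by blast
    qed
  qed
  moreover have "\<bar>L\<bar> * m b \<le> \<bar>L\<bar> * e" using mb by (intro mult_left_mono) auto
  moreover have "\<bar>L\<bar> * m a \<ge> 0" using ma by simp
  moreover have "e * (b - a + \<bar>L\<bar> + 1) = e0" using den by (simp add: e_def)
  ultimately show "f a \<le> f b + e0" using \<open>e > 0\<close> by (simp add: F_def algebra_simps)
qed

lemma has_vector_derivative_left_increment:
  fixes f :: "real \<Rightarrow> 'b::real_normed_vector"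
  assumes "(f has_vector_derivative v) (at s within {a..b})" "s \<in> {a<..b}" "e > 0"
  shows "\<forall>\<^sub>F h in at_right 0. norm (f s - f (s - h) - h *\<^sub>R v) \<le> e * h"
proof -
  have "\<forall>e>0. \<exists>d>0. \<forall>y\<in>{a..b}. norm (y - s) < d \<longrightarrow>
      norm (f y - f s - (y - s) *\<^sub>R v) \<le> e * norm (y - s)"
    using assms(1) unfolding has_vector_derivative_def has_derivative_within_alt by blast
  then obtain d where d: "d > 0" and
    D: "\<And>y. \<lbrakk>y \<in> {a..b}; norm (y - s) < d\<rbrakk> \<Longrightarrow> norm (f y - f s - (y - s) *\<^sub>R v) \<le> e * norm (y - s)"
    using \<open>e > 0\<close> by metis
  show ?thesis unfolding eventually_at_right_field
  proof (intro exI[of _ "min d (s - a)"] conjI allI impI)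
    fix h assume h: "0 < h" "h < min d (s - a)"
    have "norm (f (s - h) - f s - (s - h - s) *\<^sub>R v) \<le> e * norm (s - h - s)"
      using h assms(2) by (intro D) auto
    moreover have "f (s - h) - f s - (s - h - s) *\<^sub>R v = - (f s - f (s - h) - h *\<^sub>R v)"
      by (simp add: algebra_simps)
    ultimately show "norm (f s - f (s - h) - h *\<^sub>R v) \<le> e * h"
      using h by (metis abs_of_pos add_diff_cancel_left' diff_diff_eq2 norm_minus_cancel
          norm_minus_commute real_norm_def add.commute)
  qed (use d assms(2) in auto)
qed

section \<open>Semiconcave functions\<close>

lemma superdiff_iff:
  "p \<in> superdiff \<Omega> u x \<longleftrightarrow>
     (\<forall>e>0. \<forall>\<^sub>F y in at x within \<Omega>. u y - u x - p \<bullet> (y - x) \<le> e * norm (y - x))"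
  (is "_ \<longleftrightarrow> ?R")
proof -
  let ?X = "\<lambda>y. (u y - u x - p \<bullet> (y - x)) / norm (y - x)"
  have ne: "\<forall>\<^sub>F y in at x within \<Omega>. norm (y - x) > 0"
    by (simp add: eventually_at_filter)
  show ?thesis
  proof
    assume "p \<in> superdiff \<Omega> u x"
    then have *: "\<forall>y>0. \<forall>\<^sub>F z in at x within \<Omega>. ereal (?X z) < y"
      unfolding superdiff_def Limsup_le_iff by simp
    show ?R
    proof (intro allI impI)
      fix e :: real assume "e > 0"
      then have "\<forall>\<^sub>F z in at x within \<Omega>. ereal (?X z) < ereal e" using * by (metis ereal_less(2))
      with ne show "\<forall>\<^sub>F y in at x within \<Omega>. u y - u x - p \<bullet> (y - x) \<le> e * norm (y - x)"
        by eventually_elim (simp add: pos_divide_less_eq)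
    qed
  next
    assume R: ?R
    have "\<forall>\<^sub>F z in at x within \<Omega>. ereal (?X z) < y" if "y > 0" for y
    proof -
      obtain e where e: "ereal e < y" "e > 0"
        using ereal_dense2[OF \<open>y > 0\<close>] by (auto simp: zero_ereal_def)
      from R e(2) have "\<forall>\<^sub>F y in at x within \<Omega>. u y - u x - p \<bullet> (y - x) \<le> e * norm (y - x)"
        by blast
      with ne show ?thesis
      proof eventually_elim
        case (elim z)
        then have "?X z \<le> e" by (simp add: pos_divide_le_eq)
        then show ?case using e(1) by (meson ereal_less_eq(3) le_less_trans)
      qed
    qed
    then show "p \<in> superdiff \<Omega> u x"
      unfolding superdiff_def Limsup_le_iff by blast
  qed
qed

lemma subdiff_iff_uminus_superdiff:
  "p \<in> subdiff \<Omega> u x \<longleftrightarrow> - p \<in> superdiff \<Omega> (\<lambda>y. - u y) x"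
proof -
  let ?X = "\<lambda>y. (u y - u x - p \<bullet> (y - x)) / norm (y - x)"
  have "- ?X y = (- u y - - u x - (- p) \<bullet> (y - x)) / norm (y - x)" for y
    by (subst minus_divide_left, rule arg_cong[where f = "\<lambda>a. a / norm (y - x)"]) simp
  then have "(\<lambda>y. - ereal (?X y))
      = (\<lambda>y. ereal ((- u y - - u x - (- p) \<bullet> (y - x)) / norm (y - x)))"
    by (simp only: uminus_ereal.simps)
  then have "Liminf (at x within \<Omega>) (\<lambda>y. ereal (?X y)) = - Limsup (at x within \<Omega>)
      (\<lambda>y. ereal ((- u y - - u x - (- p) \<bullet> (y - x)) / norm (y - x)))"
    using ereal_Limsup_uminus[of "at x within \<Omega>" "\<lambda>y. ereal (?X y)"] by simp
  then show ?thesis unfolding superdiff_def subdiff_def mem_Collect_eq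
    by (simp only: ereal_0_le_uminus_iff)
qed

lemma superdiffI_quadratic:
  assumes "r > 0"
    and "\<And>y. \<lbrakk>y \<in> \<Omega>; norm (y - x) < r\<rbrakk> \<Longrightarrow> u y \<le> u x + p \<bullet> (y - x) + K * (norm (y - x))\<^sup>2"
  shows "p \<in> superdiff \<Omega> u x"
  unfolding superdiff_iff
proof (intro allI impI)
  fix e :: real assume "e > 0"
  define d where "d = min r (e / (\<bar>K\<bar> + 1))"
  have "d > 0" using assms(1) \<open>e > 0\<close> by (simp add: d_def)
  show "\<forall>\<^sub>F y in at x within \<Omega>. u y - u x - p \<bullet> (y - x) \<le> e * norm (y - x)"
    unfolding eventually_at
  proof (intro exI[of _ d] conjI ballI impI \<open>d > 0\<close>)
    fix y assume y: "y \<in> \<Omega>" "y \<noteq> x \<and> dist y x < d"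
    then have n: "norm (y - x) < r" "norm (y - x) < e / (\<bar>K\<bar> + 1)"
      by (auto simp: d_def dist_norm)
    have "K * norm (y - x) \<le> (\<bar>K\<bar> + 1) * norm (y - x)" by (intro mult_right_mono) auto
    also have "\<dots> \<le> e" using n(2) by (simp add: pos_less_divide_eq mult.commute less_imp_le)
    finally have "K * norm (y - x) * norm (y - x) \<le> e * norm (y - x)"
      by (intro mult_right_mono) auto
    then show "u y - u x - p \<bullet> (y - x) \<le> e * norm (y - x)"
      using assms(2)[OF y(1) n(1)] by (simp add: power2_eq_square)
  qed
qed

text \<open>The existential constant of \<open>semiconcave_on\<close> becomes a parameter, so that
  later radii and time steps can be chosen in terms of one and the same \<open>C\<close>.\<close>

locale semiconcave_function =
  fixes \<Omega> :: "'a::euclidean_space set" and u :: "'a \<Rightarrow> real" and C :: real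
  assumes open_dom: "open \<Omega>" and C_pos: "C > 0"
    and semiconcave: "\<And>c x y. \<lbrakk>c \<in> {0..1}; x \<in> \<Omega>; y \<in> \<Omega>; closed_segment x y \<subseteq> \<Omega>\<rbrakk> \<Longrightarrow>
       c * u x + (1 - c) * u y - u (c *\<^sub>R x + (1 - c) *\<^sub>R y)
       \<le> C / 2 * c * (1 - c) * (norm (x - y))\<^sup>2"
    and continuous_u: "continuous_on \<Omega> u"
begin

abbreviation D where "D \<equiv> superdiff \<Omega> u"

text \<open>The defining inequality holds only near \<open>x\<close>. It is used at a single point
  \<open>z\<close> of the segment close to \<open>x\<close>; semiconcavity carries it to
  \<open>y\<close> after division by the fraction \<open>s\<close>.\<close>

lemma superdiff_upper_bound:
  assumes "p \<in> D x" "x \<in> \<Omega>" and seg: "closed_segment x y \<subseteq> \<Omega>"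
  shows "u y \<le> u x + p \<bullet> (y - x) + C / 2 * (norm (y - x))\<^sup>2"
proof (cases "y = x")
  case False
  have y: "y \<in> \<Omega>" using seg by auto
  have n: "norm (y - x) > 0" using False by simp
  show ?thesis
  proof (rule field_le_epsilon)
    fix e0 :: real assume "e0 > 0"
    \<comment> \<open>Scaled so that the error at \<open>z\<close> is \<open>s * e0\<close>, which
      the division by \<open>s\<close> turns into \<open>e0\<close>.\<close>
    define e where "e = e0 / norm (y - x)"
    have "e > 0" using \<open>e0 > 0\<close> n by (simp add: e_def)
    then obtain d where d: "d > 0" and
      dd: "\<And>z. \<lbrakk>z \<in> \<Omega>; z \<noteq> x; dist z x < d\<rbrakk> \<Longrightarrow> u z - u x - p \<bullet> (z - x) \<le> e * norm (z - x)"
      using assms(1) unfolding superdiff_iff eventually_at by metis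
    define s where "s = min 1 (d / (2 * norm (y - x)))"
    have s: "0 < s" "s \<le> 1" using d n by (auto simp: s_def)
    have sn: "s * norm (y - x) < d"
    proof -
      have "s * norm (y - x) \<le> d / (2 * norm (y - x)) * norm (y - x)"
        by (intro mult_right_mono) (auto simp: s_def)
      then show ?thesis using n d by simp
    qed
    define z where "z = s *\<^sub>R y + (1 - s) *\<^sub>R x"
    have zx: "z - x = s *\<^sub>R (y - x)" by (simp add: z_def algebra_simps)
    have "z \<in> closed_segment x y"
      unfolding in_segment using s by (intro exI[of _ s]) (auto simp: z_def algebra_simps)
    then have "z \<in> \<Omega>" using seg by blast
    moreover have "z \<noteq> x" using zx s False by auto
    moreover have "dist z x < d" using sn s by (simp add: dist_norm zx)
    ultimately have "u z - u x - p \<bullet> (z - x) \<le> e * norm (z - x)" by (rule dd)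
    moreover have "e * norm (z - x) = s * e0" "p \<bullet> (z - x) = s * (p \<bullet> (y - x))"
      unfolding zx norm_scaleR using s n by (simp_all add: e_def)
    ultimately have uz: "u z \<le> u x + s * (p \<bullet> (y - x)) + s * e0" by simp
    have "s * u y + (1 - s) * u x - u z \<le> C / 2 * s * (1 - s) * (norm (y - x))\<^sup>2"
      unfolding z_def using s y assms(2) seg
      by (intro semiconcave) (auto simp: closed_segment_commute)
    also have "\<dots> \<le> C / 2 * s * 1 * (norm (y - x))\<^sup>2"
      using s C_pos by (intro mult_right_mono mult_left_mono) auto
    finally have "s * u y \<le> s * (u x + p \<bullet> (y - x) + C / 2 * (norm (y - x))\<^sup>2 + e0)"
      using uz by (simp add: algebra_simps)
    then show "u y \<le> u x + p \<bullet> (y - x) + C / 2 * (norm (y - x))\<^sup>2 + e0"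
      using s by simp
  qed
qed simp

text \<open>Adding the upper bounds based at the two points cancels the values of \<open>u\<close>.
  For concave functions this is the familiar monotonicity; here it holds up to a quadratic
  error.\<close>

lemma superdiff_almost_monotone:
  assumes "p \<in> D x" "q \<in> D y" "x \<in> \<Omega>" "y \<in> \<Omega>" "closed_segment x y \<subseteq> \<Omega>"
  shows "(p - q) \<bullet> (x - y) \<le> C * (norm (x - y))\<^sup>2"
proof -
  have "u y \<le> u x + p \<bullet> (y - x) + C / 2 * (norm (y - x))\<^sup>2"
    "u x \<le> u y + q \<bullet> (x - y) + C / 2 * (norm (x - y))\<^sup>2"
    by (rule superdiff_upper_bound; use assms in \<open>simp add: closed_segment_commute\<close>)+
  then show ?thesis
    by (simp add: norm_minus_commute inner_diff_left inner_diff_right algebra_simps)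
qed

lemma segment_in_ball:
  assumes "ball x r \<subseteq> \<Omega>" "y \<in> ball x r" "z \<in> ball x r"
  shows "closed_segment y z \<subseteq> \<Omega>"
  using closed_segment_subset[OF assms(2,3) convex_ball] assms(1) by simp

lemma ball_in_dom:
  assumes "x \<in> \<Omega>"
  obtains r where "r > 0" "ball x r \<subseteq> \<Omega>"
proof -
  obtain r where "r > 0" "ball x r \<subseteq> \<Omega>"
    using open_dom assms unfolding open_contains_ball by blast
  then show ?thesis by (rule that)
qed

text \<open>The quadratic upper bound holds on a ball of fixed size, so unlike the limit in the
  definition it survives the passage to the limit along the sequence.\<close>

lemma superdiff_closed_graph:
  assumes "x \<in> \<Omega>" "X \<longlonglongrightarrow> x" "P \<longlonglongrightarrow> p" "\<And>k::nat. P k \<in> D (X k)"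
  shows "p \<in> D x"
proof -
  obtain r where r: "r > 0" "ball x r \<subseteq> \<Omega>" using ball_in_dom assms(1) by blast
  show ?thesis
  proof (rule superdiffI_quadratic[OF r(1)])
    fix y assume "y \<in> \<Omega>" and y: "norm (y - x) < r"
    have ev: "\<forall>\<^sub>F k in sequentially. X k \<in> ball x r"
      using assms(2) r(1) by (metis centre_in_ball open_ball topological_tendstoD)
    have cont: "(\<lambda>k. u (X k)) \<longlonglongrightarrow> u x"
    proof (rule continuous_on_tendsto_compose[OF continuous_u assms(2,1)])
      show "\<forall>\<^sub>F k in sequentially. X k \<in> \<Omega>" using ev by eventually_elim (use r in auto)
    qed
    have "(\<lambda>k. u (X k) + P k \<bullet> (y - X k) + C / 2 * (norm (y - X k))\<^sup>2)
            \<longlonglongrightarrow> u x + p \<bullet> (y - x) + C / 2 * (norm (y - x))\<^sup>2"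
      by (intro tendsto_intros assms cont)
    moreover have "\<forall>\<^sub>F k in sequentially. u y \<le> u (X k) + P k \<bullet> (y - X k) + C / 2 * (norm (y - X k))\<^sup>2"
      using ev
    proof eventually_elim
      case (elim k)
      then show ?case
        using r y assms(4) by (intro superdiff_upper_bound segment_in_ball[OF r(2)])
          (auto simp: dist_norm norm_minus_commute)
    qed
    ultimately show "u y \<le> u x + p \<bullet> (y - x) + C / 2 * (norm (y - x))\<^sup>2"
      by (rule tendsto_lowerbound) simp
  qed
qed

lemma superdiff_locally_bounded:
  assumes "x \<in> \<Omega>"
  obtains r M where "r > 0" "cball x r \<subseteq> \<Omega>" "\<And>y p. \<lbrakk>y \<in> ball x r; p \<in> D y\<rbrakk> \<Longrightarrow> norm p \<le> M"
proof -
  obtain r where r: "r > 0" "cball x r \<subseteq> \<Omega>"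
    using assms open_dom by (meson open_contains_cball)
  have "bounded (u ` cball x r)"
    by (intro compact_imp_bounded compact_continuous_image continuous_on_subset[OF continuous_u] r)
      auto
  then obtain B where "\<forall>y\<in>cball x r. \<bar>u y\<bar> \<le> B"
    unfolding bounded_iff by auto
  then have B: "\<And>y. y \<in> cball x r \<Longrightarrow> \<bar>u y\<bar> \<le> B" by blast
  define t where "t = r / 2"
  have t: "t > 0" using r by (simp add: t_def)
  have "norm p \<le> (2 * B + C / 2 * t\<^sup>2) / t" if y: "y \<in> ball x t" and p: "p \<in> D y" for y p
  proof (cases "p = 0")
    case True
    have "B \<ge> 0" using B[of x] r by auto
    then show ?thesis using True t C_pos by simp
  next
    case False
    \<comment> \<open>A step of fixed length \<open>t\<close> against \<open>p\<close> lowers the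
      upper bound for \<open>u\<close> by \<open>t * norm p\<close>, which the boundedness of
      \<open>u\<close> limits. The halved radius keeps \<open>z\<close> where \<open>u\<close> is
      bounded.\<close>
    define z where "z = y - (t / norm p) *\<^sub>R p"
    have zy: "z - y = - (t / norm p) *\<^sub>R p" "norm (z - y) = t" using False t by (auto simp: z_def)
    have "dist x z \<le> dist x y + dist y z" by (rule dist_triangle)
    also have "\<dots> < r" using y zy(2) by (simp add: t_def dist_norm norm_minus_commute)
    finally have z: "z \<in> ball x r" by simp
    have yr: "y \<in> ball x r" using y r by (auto simp: t_def)
    have "u z \<le> u y + p \<bullet> (z - y) + C / 2 * (norm (z - y))\<^sup>2"
      using r yr z p by (intro superdiff_upper_bound segment_in_ball[of x r])
        (auto intro: subset_trans[OF ball_subset_cball])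
    moreover have "p \<bullet> (z - y) = - t * norm p"
      using False by (simp add: zy(1) dot_square_norm power2_eq_square)
    moreover have "\<bar>u z\<bar> \<le> B" "\<bar>u y\<bar> \<le> B" using B z yr by auto
    ultimately have "norm p * t \<le> 2 * B + C / 2 * t\<^sup>2" by (simp add: zy(2) algebra_simps)
    then show ?thesis using t by (simp add: pos_le_divide_eq)
  qed
  moreover have "cball x t \<subseteq> \<Omega>" using r by (auto simp: t_def)
  ultimately show ?thesis using that[of t] t by blast
qed

lemma superdiff_subsequence:
  assumes "x \<in> \<Omega>" "X \<longlonglongrightarrow> x" "\<And>k::nat. P k \<in> D (X k)"
  obtains p s where "p \<in> D x" "strict_mono s" "(P \<circ> s) \<longlonglongrightarrow> p"
proof -
  obtain r M where r: "r > 0" "\<And>y p. \<lbrakk>y \<in> ball x r; p \<in> D y\<rbrakk> \<Longrightarrow> norm p \<le> M"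
    using superdiff_locally_bounded[OF assms(1)] by metis
  have "\<forall>\<^sub>F k in sequentially. X k \<in> ball x r"
    using assms(2) r(1) by (metis centre_in_ball open_ball topological_tendstoD)
  then obtain N where N: "\<And>k. k \<ge> N \<Longrightarrow> X k \<in> ball x r" by (auto simp: eventually_sequentially)
  have "P (k + N) \<in> cball 0 M" for k using r(2)[OF N[of "k + N"] assms(3)] by simp
  then obtain p s where s: "strict_mono (s :: nat \<Rightarrow> nat)" "((\<lambda>k. P (k + N)) \<circ> s) \<longlonglongrightarrow> p"
    using compact_cball[of "0::'a" M] unfolding compact_def by metis
  define s' where "s' k = s k + N" for k
  have s': "strict_mono s'" using s(1) by (simp add: s'_def strict_mono_def)
  have lim: "(P \<circ> s') \<longlonglongrightarrow> p" using s(2) by (simp add: s'_def o_def)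
  have "p \<in> D x"
    by (rule superdiff_closed_graph[OF assms(1) LIMSEQ_subseq_LIMSEQ[OF assms(2) s'] lim])
      (simp add: assms(3))
  then show ?thesis using that s' lim by blast
qed

lemma compact_superdiff:
  assumes "x \<in> \<Omega>"
  shows "compact (D x)"
  unfolding compact_def
proof (intro allI impI)
  fix f :: "nat \<Rightarrow> 'a" assume "\<forall>n. f n \<in> D x"
  then show "\<exists>l\<in>D x. \<exists>r. strict_mono r \<and> (f \<circ> r) \<longlonglongrightarrow> l"
    using superdiff_subsequence[OF assms tendsto_const, of f] by metis
qed

lemma convex_superdiff: "convex (D x)"
proof (rule convexI)
  fix p q and a b :: real
  assume p: "p \<in> D x" and q: "q \<in> D x" and ab: "a \<ge> 0" "b \<ge> 0" "a + b = 1"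
  show "a *\<^sub>R p + b *\<^sub>R q \<in> D x"
    unfolding superdiff_iff
  proof (intro allI impI)
    fix e :: real assume "e > 0"
    with p q have "\<forall>\<^sub>F y in at x within \<Omega>. u y - u x - p \<bullet> (y - x) \<le> e * norm (y - x)"
      "\<forall>\<^sub>F y in at x within \<Omega>. u y - u x - q \<bullet> (y - x) \<le> e * norm (y - x)"
      unfolding superdiff_iff by blast+
    then show "\<forall>\<^sub>F y in at x within \<Omega>.
        u y - u x - (a *\<^sub>R p + b *\<^sub>R q) \<bullet> (y - x) \<le> e * norm (y - x)"
    proof eventually_elim
      case (elim y)
      have "a * (u y - u x - p \<bullet> (y - x)) + b * (u y - u x - q \<bullet> (y - x))
          \<le> a * (e * norm (y - x)) + b * (e * norm (y - x))"
        using elim ab by (intro add_mono mult_left_mono) auto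
      moreover have "a * (u y - u x) + b * (u y - u x) = u y - u x"
        "a * (e * norm (y - x)) + b * (e * norm (y - x)) = e * norm (y - x)"
        using ab(3) by (metis distrib_right mult_1)+
      ultimately show ?case
        by (simp add: inner_add_left right_diff_distrib)
    qed
  qed
qed

text \<open>Upper semicontinuity of the set-valued map \<open>D\<close>, in the form in which it is
  applied: violations at points tending to \<open>x\<close> would accumulate at some element of
  \<open>D x\<close>.\<close>

lemma superdiff_tube:
  fixes g :: "'a \<Rightarrow> 'a \<Rightarrow> real"
  assumes "x \<in> \<Omega>" and g: "continuous_on (\<Omega> \<times> UNIV) (\<lambda>(x, p). g x p)"
    and pos: "\<And>q. q \<in> D x \<Longrightarrow> g x q > 0"
  obtains r where "r > 0" "ball x r \<subseteq> \<Omega>" "\<And>y q. \<lbrakk>y \<in> ball x r; q \<in> D y\<rbrakk> \<Longrightarrow> g y q > 0"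
proof -
  obtain r0 where r0: "r0 > 0" "ball x r0 \<subseteq> \<Omega>" using ball_in_dom assms(1) by blast
  have "\<exists>r>0. \<forall>y q. y \<in> ball x r \<inter> \<Omega> \<and> q \<in> D y \<longrightarrow> g y q > 0"
  proof (rule ccontr)
    assume "\<not> ?thesis"
    then have "\<forall>k. \<exists>y q. y \<in> ball x (inverse (Suc k)) \<inter> \<Omega> \<and> q \<in> D y \<and> g y q \<le> 0"
      by (metis inverse_positive_iff_positive not_le of_nat_0_less_iff zero_less_Suc)
    then obtain X P where XP: "\<And>k::nat. X k \<in> ball x (inverse (Suc k)) \<inter> \<Omega>" "\<And>k. P k \<in> D (X k)"
      "\<And>k. g (X k) (P k) \<le> 0"
      by metis
    have X: "X \<longlonglongrightarrow> x"
    proof (rule metric_LIMSEQ_I)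
      fix e :: real assume "e > 0"
      then obtain n where "inverse (Suc n) < e" using reals_Archimedean by blast
      moreover have "dist (X k) x < inverse (Suc n)" if "k \<ge> n" for k
      proof -
        have "dist (X k) x < inverse (Suc k)" using XP(1)[of k] by (simp add: dist_commute)
        also have "\<dots> \<le> inverse (Suc n)" using that by (intro le_imp_inverse_le) auto
        finally show ?thesis .
      qed
      ultimately show "\<exists>n. \<forall>k\<ge>n. dist (X k) x < e" by (meson less_trans)
    qed
    obtain p s where s: "p \<in> D x" "strict_mono s" "(P \<circ> s) \<longlonglongrightarrow> p"
      using superdiff_subsequence[OF assms(1) X XP(2)] by blast
    have "(\<lambda>k. (X (s k), P (s k))) \<longlonglongrightarrow> (x, p)"
      using LIMSEQ_subseq_LIMSEQ[OF X s(2)] s(3) by (intro tendsto_Pair) (auto simp: o_def)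
    then have "(\<lambda>k. (\<lambda>(x, p). g x p) (X (s k), P (s k))) \<longlonglongrightarrow> (\<lambda>(x, p). g x p) (x, p)"
      by (rule continuous_on_tendsto_compose[OF g]) (use XP assms(1) in auto)
    then have "g x p \<le> 0"
      by (simp add: LIMSEQ_le_const2 XP(3))
    then show False using pos s(1) by fastforce
  qed
  then obtain r where "r > 0" "\<And>y q. \<lbrakk>y \<in> ball x r \<inter> \<Omega>; q \<in> D y\<rbrakk> \<Longrightarrow> g y q > 0"
    by blast
  then show ?thesis using r0 by (intro that[of "min r r0"]) auto
qed

section \<open>Points of differentiability and limits of gradients\<close>

lemma superdiffI_touching_below:
  assumes "x \<in> \<Omega>" "r > 0" "ball x r \<subseteq> \<Omega>"
    and touch: "\<And>y. y \<in> ball x r \<Longrightarrow> u y \<ge> u x + p \<bullet> (y - x) - K * (norm (y - x))\<^sup>2"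
  shows "p \<in> D x"
proof (rule superdiffI_quadratic[OF \<open>r > 0\<close>])
  fix y assume "y \<in> \<Omega>" and "norm (y - x) < r"
  \<comment> \<open>The reflection of \<open>y\<close> in \<open>x\<close>. Midpoint semiconcavity
    bounds \<open>u y + u z\<close> from above, so the lower bound at \<open>z\<close> becomes an
    upper bound at \<open>y\<close>.\<close>
  define z where "z = 2 *\<^sub>R x - y"
  have yz: "y \<in> ball x r" "z \<in> ball x r"
    using \<open>norm (y - x) < r\<close> by (auto simp: z_def dist_norm norm_minus_commute algebra_simps scaleR_2)
  have "1/2 * u y + (1 - 1/2) * u z - u ((1/2) *\<^sub>R y + (1 - 1/2) *\<^sub>R z)
      \<le> C / 2 * (1/2) * (1 - 1/2) * (norm (y - z))\<^sup>2"
    using yz assms(3) segment_in_ball[OF assms(3)] by (intro semiconcave) auto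
  moreover have "(1/2) *\<^sub>R y + (1 - 1/2) *\<^sub>R z = x" by (simp add: z_def algebra_simps)
  moreover have "y - z = 2 *\<^sub>R (y - x)" by (simp add: z_def algebra_simps scaleR_2)
  then have "(norm (y - z))\<^sup>2 = 4 * (norm (y - x))\<^sup>2" by (simp add: power_mult_distrib)
  ultimately have "u y + u z \<le> 2 * u x + C * (norm (y - x))\<^sup>2" by simp
  moreover have zx: "z - x = - (y - x)" by (simp add: z_def scaleR_2)
  have "u z \<ge> u x + p \<bullet> (z - x) - K * (norm (z - x))\<^sup>2" using touch yz by blast
  then have "u z \<ge> u x - p \<bullet> (y - x) - K * (norm (y - x))\<^sup>2"
    unfolding zx norm_minus_cancel inner_minus_right by simp
  ultimately show "u y \<le> u x + p \<bullet> (y - x) + (C + K) * (norm (y - x))\<^sup>2"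
    by (simp add: distrib_right)
qed

text \<open>Membership in both semidifferentials encodes that \<open>q\<close> is the gradient at
  \<open>z\<close>. Such a \<open>z\<close> is a minimizer of \<open>u\<close> plus a steep
  paraboloid centred at \<open>w\<close>: there \<open>u\<close> is touched from below by a
  paraboloid.\<close>

lemma differentiable_points_dense:
  assumes "w \<in> \<Omega>" "e > 0"
  obtains z q where "z \<in> \<Omega>" "dist w z < e" "q \<in> D z" "q \<in> subdiff \<Omega> u z"
proof -
  obtain r0 where r0: "r0 > 0" "cball w r0 \<subseteq> \<Omega>"
    using assms(1) open_dom by (meson open_contains_cball)
  define r where "r = min r0 e"
  have r: "r > 0" "cball w r \<subseteq> \<Omega>" "r \<le> e" using r0 assms(2) by (auto simp: r_def)
  have cu: "continuous_on (cball w r) u" by (rule continuous_on_subset[OF continuous_u r(2)])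
  have "bounded (u ` cball w r)" by (intro compact_imp_bounded compact_continuous_image cu) auto
  then obtain B where "\<forall>y\<in>cball w r. \<bar>u y\<bar> \<le> B"
    unfolding bounded_iff by auto
  then have B: "\<And>y. y \<in> cball w r \<Longrightarrow> \<bar>u y\<bar> \<le> B" by blast
  have "B \<ge> 0" using B[of w] r by auto
  \<comment> \<open>On the sphere of radius \<open>r\<close> the penalty is
    \<open>2 * B + 1\<close>, more than \<open>u\<close> can vary, so the minimizer is
    interior.\<close>
  define K where "K = (2 * B + 1) / r\<^sup>2"
  have "\<exists>z\<in>cball w r. \<forall>y\<in>cball w r. u z + K * (norm (z - w))\<^sup>2 \<le> u y + K * (norm (y - w))\<^sup>2"
    using r by (intro continuous_attains_inf continuous_intros cu) auto
  then obtain z where z: "z \<in> cball w r" and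
    min: "\<And>y. y \<in> cball w r \<Longrightarrow> u z + K * (norm (z - w))\<^sup>2 \<le> u y + K * (norm (y - w))\<^sup>2"
    by blast
  have "norm (z - w) < r"
  proof (rule ccontr)
    assume "\<not> norm (z - w) < r"
    with z have "norm (z - w) = r" by (simp add: dist_norm norm_minus_commute)
    then have "u z + (2 * B + 1) \<le> u w" using min[of w] r by (simp add: K_def)
    then show False using B[of w] B[of z] z r by auto
  qed
  then have zr: "dist w z < r" by (simp add: dist_norm norm_minus_commute)
  define r' where "r' = r - dist w z"
  have r': "r' > 0" using zr by (simp add: r'_def)
  have sub: "ball z r' \<subseteq> cball w r"
  proof
    fix y assume "y \<in> ball z r'"
    then show "y \<in> cball w r"
      using dist_triangle[of w y z] by (simp add: r'_def)
  qed
  define q where "q = - (2 * K) *\<^sub>R (z - w)"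
  have touch: "u y \<ge> u z + q \<bullet> (y - z) - K * (norm (y - z))\<^sup>2" if "y \<in> ball z r'" for y
  proof -
    have "(norm (y - w))\<^sup>2 = (norm (y - z))\<^sup>2 + 2 * ((z - w) \<bullet> (y - z)) + (norm (z - w))\<^sup>2"
      unfolding power2_norm_eq_inner by (simp add: algebra_simps inner_commute)
    moreover have "u z + K * (norm (z - w))\<^sup>2 \<le> u y + K * (norm (y - w))\<^sup>2"
      using min sub that by blast
    moreover from calculation(1) have "K * (norm (y - w))\<^sup>2
        = K * (norm (y - z))\<^sup>2 + 2 * K * ((z - w) \<bullet> (y - z)) + K * (norm (z - w))\<^sup>2"
      by (simp add: distrib_left)
    moreover have "q \<bullet> (y - z) = - 2 * K * ((z - w) \<bullet> (y - z))" by (simp add: q_def)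
    ultimately show ?thesis by linarith
  qed
  have zO: "z \<in> \<Omega>" using z r by blast
  have "q \<in> D z"
    using touch sub r(2) by (intro superdiffI_touching_below[OF zO r', of q K]) auto
  moreover have "q \<in> subdiff \<Omega> u z"
    unfolding subdiff_iff_uminus_superdiff
    by (rule superdiffI_quadratic[OF r', of _ _ _ _ K])
      (use touch in \<open>force simp: dist_norm norm_minus_commute\<close>)
  ultimately show ?thesis using that[of z q] zO zr r by auto
qed

text \<open>Points of differentiability approach \<open>x\<close> from the direction
  \<open>- n\<close>. Almost monotonicity between \<open>Z k\<close> and \<open>x\<close>, divided
  by the distance scale, leaves \<open>(q - q') \<bullet> (- n) \<le> 0\<close> in the
  limit.\<close>

lemma extreme_reachable_gradient:
  assumes "x \<in> \<Omega>"
  obtains q Z Q where "q \<in> D x" "\<And>q'. q' \<in> D x \<Longrightarrow> q' \<bullet> n \<le> q \<bullet> n"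
    "\<And>k::nat. Z k \<in> \<Omega>" "Z \<longlonglongrightarrow> x" "\<And>k. Q k \<in> D (Z k)" "\<And>k. Q k \<in> subdiff \<Omega> u (Z k)" "Q \<longlonglongrightarrow> q"
proof -
  obtain r where r: "r > 0" "ball x r \<subseteq> \<Omega>" using ball_in_dom assms by blast
  define h where "h k = inverse (real (Suc k))" for k
  have hpos: "h k > 0" for k by (simp add: h_def)
  have h0: "h \<longlonglongrightarrow> 0" unfolding h_def by (rule LIMSEQ_inverse_real_of_nat)
  define w where "w k = x - h k *\<^sub>R n" for k
  have "w \<longlonglongrightarrow> x - 0 *\<^sub>R n" unfolding w_def by (intro tendsto_intros h0)
  then have w: "w \<longlonglongrightarrow> x" by simp
  have "\<exists>z q. w k \<in> \<Omega> \<longrightarrow> (z \<in> \<Omega> \<and> dist (w k) z < (h k)\<^sup>2 \<and> q \<in> D z \<and> q \<in> subdiff \<Omega> u z)" for k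
    \<comment> \<open>The tolerance is of second order in \<open>h k\<close>, so that the
      displacement from \<open>x\<close> is \<open>- h k *\<^sub>R n\<close> up to
      \<open>o(h k)\<close>.\<close>
    using differentiable_points_dense[of "w k" "(h k)\<^sup>2"] hpos[of k] by (metis zero_less_power)
  then obtain Z Q where ZQ: "\<And>k. w k \<in> \<Omega> \<Longrightarrow>
      Z k \<in> \<Omega> \<and> dist (w k) (Z k) < (h k)\<^sup>2 \<and> Q k \<in> D (Z k) \<and> Q k \<in> subdiff \<Omega> u (Z k)"
    by metis
  have "\<forall>\<^sub>F k in sequentially. w k \<in> \<Omega>" using w assms open_dom by (metis topological_tendstoD)
  then obtain N where N: "\<And>k. k \<ge> N \<Longrightarrow> w k \<in> \<Omega>" by (auto simp: eventually_sequentially)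
  define Z' where "Z' k = Z (k + N)" for k
  define Q' where "Q' k = Q (k + N)" for k
  have ZQ': "Z' k \<in> \<Omega>" "dist (w (k+N)) (Z' k) < (h (k+N))\<^sup>2" "Q' k \<in> D (Z' k)"
      "Q' k \<in> subdiff \<Omega> u (Z' k)" for k
    using ZQ[OF N[of "k+N"]] by (auto simp: Z'_def Q'_def)
  define E where "E k = (1 / h (k+N)) *\<^sub>R (Z' k - w (k+N))" for k
  have hN: "(\<lambda>k. h (k+N)) \<longlonglongrightarrow> 0" using LIMSEQ_ignore_initial_segment[OF h0] .
  have E: "E \<longlonglongrightarrow> 0"
  proof (rule Lim_null_comparison[OF _ hN])
    show "\<forall>\<^sub>F k in sequentially. norm (E k) \<le> h (k+N)"
    proof (rule always_eventually, rule allI)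
      fix k
      have "norm (Z' k - w (k+N)) \<le> h (k+N) * h (k+N)"
        using ZQ'(2)[of k] by (simp add: dist_norm norm_minus_commute power2_eq_square)
      then show "norm (E k) \<le> h (k+N)"
        using hpos[of "k+N"] by (simp add: E_def pos_divide_le_eq)
    qed
  qed
  have Zx: "Z' k - x = h (k+N) *\<^sub>R (E k - n)" for k
    using hpos[of "k+N"] by (simp add: E_def w_def algebra_simps)
  have "(\<lambda>k. x + h (k+N) *\<^sub>R (E k - n)) \<longlonglongrightarrow> x + 0 *\<^sub>R (0 - n)"
    by (intro tendsto_intros hN E)
  moreover have "x + h (k+N) *\<^sub>R (E k - n) = Z' k" for k
    unfolding Zx[symmetric] by simp
  ultimately have Z'lim: "Z' \<longlonglongrightarrow> x" by simp
  obtain q s where q: "q \<in> D x" "strict_mono s" "(Q' \<circ> s) \<longlonglongrightarrow> q"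
    using superdiff_subsequence[OF assms Z'lim ZQ'(3)] by blast
  have sub0: "(Z' \<circ> s) \<longlonglongrightarrow> x" "(E \<circ> s) \<longlonglongrightarrow> 0" "((\<lambda>k. h (k+N)) \<circ> s) \<longlonglongrightarrow> 0"
    using LIMSEQ_subseq_LIMSEQ q(2) Z'lim E hN by blast+
  have "q' \<bullet> n \<le> q \<bullet> n" if "q' \<in> D x" for q'
  proof -
    have "\<forall>\<^sub>F k in sequentially. Z' (s k) \<in> ball x r"
      using sub0(1) r(1) unfolding o_def by (metis centre_in_ball open_ball topological_tendstoD)
    then have ev: "\<forall>\<^sub>F k in sequentially. (Q' (s k) - q') \<bullet> (E (s k) - n)
        \<le> C * h (s k + N) * (norm (E (s k) - n))\<^sup>2"
    proof eventually_elim
      case (elim k)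
      have "(Q' (s k) - q') \<bullet> (Z' (s k) - x) \<le> C * (norm (Z' (s k) - x))\<^sup>2"
        using elim r ZQ' that assms
        by (intro superdiff_almost_monotone segment_in_ball[OF r(2)]) auto
      then have "h (s k + N) * ((Q' (s k) - q') \<bullet> (E (s k) - n))
          \<le> h (s k + N) * (C * h (s k + N) * (norm (E (s k) - n))\<^sup>2)"
        unfolding Zx inner_scaleR_right norm_scaleR power_mult_distrib power2_abs
        by (simp add: power2_eq_square mult_ac)
      then show ?case using hpos[of "s k + N"] by simp
    qed
    have "(\<lambda>k. (Q' (s k) - q') \<bullet> (E (s k) - n)) \<longlonglongrightarrow> (q - q') \<bullet> (0 - n)"
      "(\<lambda>k. C * h (s k + N) * (norm (E (s k) - n))\<^sup>2) \<longlonglongrightarrow> C * 0 * (norm (0 - n))\<^sup>2"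
      by (intro tendsto_intros q(3)[unfolded o_def] sub0(2,3)[unfolded o_def])+
    from tendsto_le[OF sequentially_bot this(2,1) ev] show ?thesis by (simp add: inner_diff_left)
  qed
  with q(1) show ?thesis by (rule that[of q "Z' \<circ> s" "Q' \<circ> s"]) (use q sub0 ZQ' in simp_all)
qed

text \<open>With direction 0 extremality is trivial, and the construction still yields a limit of
  gradients.\<close>

lemma superdiff_nonempty: "x \<in> \<Omega> \<Longrightarrow> D x \<noteq> {}"
  by (rule extreme_reachable_gradient[of x 0]) auto

end

section \<open>Viscosity solutions and their characteristics\<close>

locale semiconcave_viscosity_solution = semiconcave_function \<Omega> u C
  for \<Omega> :: "'a::euclidean_space set" and u C +
  fixes H :: "'a \<Rightarrow> 'a \<Rightarrow> real"
  assumes H_C1: "C1_on (\<Omega> \<times> UNIV) (\<lambda>(x, p). H x p)"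
    and H_strictly_convex: "x \<in> \<Omega> \<Longrightarrow> strictly_convex_on UNIV (H x)"
    and visc: "viscosity_solution \<Omega> H u"
begin

text \<open>The gradient in \<open>p\<close> is the second component of the joint gradient;
  uniqueness of gradients identifies it with the description in \<open>grad\<close>, which thus
  inherits joint continuity.\<close>

lemma
  shows GDERIV_H: "x \<in> \<Omega> \<Longrightarrow> GDERIV (H x) p :> H_p H x p"
    and continuous_H_p: "continuous_on (\<Omega> \<times> UNIV) (\<lambda>(x, p). H_p H x p)"
    and continuous_H: "continuous_on (\<Omega> \<times> UNIV) (\<lambda>(x, p). H x p)"
proof -
  obtain g where g: "continuous_on (\<Omega> \<times> UNIV) g"
    "\<And>z. z \<in> \<Omega> \<times> UNIV \<Longrightarrow> GDERIV (\<lambda>(x, p). H x p) z :> g z"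
    using H_C1 unfolding C1_on_def by blast
  have d: "GDERIV (H x) p :> snd (g (x, p))" if "x \<in> \<Omega>" for x p
  proof -
    have 1: "((\<lambda>(x, p). H x p) has_derivative (\<lambda>h. h \<bullet> g (x, p))) (at (x, p))"
      using g(2)[of "(x, p)"] that unfolding gderiv_def by simp
    have 2: "((\<lambda>p. (x, p)) has_derivative (\<lambda>h. (0, h))) (at p)"
      by (auto intro!: derivative_eq_intros)
    have "((\<lambda>(x, p). H x p) \<circ> (\<lambda>p. (x, p)) has_derivative (\<lambda>h. h \<bullet> g (x, p)) \<circ> (\<lambda>h. (0, h))) (at p)"
      by (rule diff_chain_at[OF 2 1])
    moreover have "(\<lambda>h. h \<bullet> g (x, p)) \<circ> (\<lambda>h. (0, h)) = (\<lambda>h. h \<bullet> snd (g (x, p)))"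
      by (cases "g (x, p)") (auto simp: fun_eq_iff)
    ultimately show ?thesis unfolding gderiv_def by (simp add: o_def)
  qed
  have uniq: "a = b" if "GDERIV f p :> a" "GDERIV f p :> b" for f :: "'a \<Rightarrow> real" and p a b
  proof -
    have "(\<lambda>h. h \<bullet> a) = (\<lambda>h. h \<bullet> b)"
      using that has_derivative_unique unfolding gderiv_def by blast
    then have "h \<bullet> a = h \<bullet> b" for h by meson
    then show ?thesis by (metis inner_eq_zero_iff inner_diff_right right_minus_eq)
  qed
  have eq: "H_p H x p = snd (g (x, p))" if "x \<in> \<Omega>" for x p
    unfolding grad_def using d[OF that] uniq by (intro the_equality) auto
  show "GDERIV (H x) p :> H_p H x p" if "x \<in> \<Omega>" for x p
    unfolding eq[OF that] by (rule d[OF that])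
  have "continuous_on (\<Omega> \<times> UNIV) (\<lambda>z. snd (g z))" by (intro continuous_intros g)
  then show "continuous_on (\<Omega> \<times> UNIV) (\<lambda>(x, p). H_p H x p)"
    by (rule continuous_on_eq) (auto simp: eq)
  have "isCont (\<lambda>(x, p). H x p) z" if "z \<in> \<Omega> \<times> UNIV" for z
    using g(2)[OF that] unfolding gderiv_def by (rule has_derivative_continuous)
  then show "continuous_on (\<Omega> \<times> UNIV) (\<lambda>(x, p). H x p)"
    by (rule continuous_at_imp_continuous_on[rule_format])
qed

lemma continuous_H_compose [continuous_intros]:
  "\<lbrakk>continuous_on S f; continuous_on S q; \<And>s. s \<in> S \<Longrightarrow> f s \<in> \<Omega>\<rbrakk> \<Longrightarrow> continuous_on S (\<lambda>s. H (f s) (q s))"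
  using continuous_on_compose2[OF continuous_H, of S "\<lambda>s. (f s, q s)"]
  by (auto intro: continuous_on_Pair)

lemma continuous_H_p_compose [continuous_intros]:
  "\<lbrakk>continuous_on S f; continuous_on S q; \<And>s. s \<in> S \<Longrightarrow> f s \<in> \<Omega>\<rbrakk>
    \<Longrightarrow> continuous_on S (\<lambda>s. H_p H (f s) (q s))"
  using continuous_on_compose2[OF continuous_H_p, of S "\<lambda>s. (f s, q s)"]
  by (auto intro: continuous_on_Pair)

lemma H_strict:
  assumes "x \<in> \<Omega>" "p \<noteq> q" "0 < c" "c < 1"
  shows "H x (c *\<^sub>R p + (1 - c) *\<^sub>R q) < c * H x p + (1 - c) * H x q"
  using H_strictly_convex[OF assms(1)] assms(2-) unfolding strictly_convex_on_def by blast

lemma H_above_tangent: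
  assumes x: "x \<in> \<Omega>"
  shows "H x q \<ge> H x p + H_p H x p \<bullet> (q - p)"
proof (cases "p = q")
  case False
  have "((\<lambda>c. H x (p + c *\<^sub>R (q - p))) has_derivative (\<lambda>c. (c *\<^sub>R (q - p)) \<bullet> H_p H x p)) (at 0)"
  proof -
    have 1: "((\<lambda>c. p + c *\<^sub>R (q - p)) has_derivative (\<lambda>c. c *\<^sub>R (q - p))) (at (0::real))"
      by (auto intro!: derivative_eq_intros)
    have 2: "(H x has_derivative (\<lambda>h. h \<bullet> H_p H x p)) (at (p + 0 *\<^sub>R (q - p)))"
      using GDERIV_H[OF x, of p] unfolding gderiv_def by simp
    show ?thesis using diff_chain_at[OF 1 2] by (simp add: o_def)
  qed
  then have "((\<lambda>c. H x (p + c *\<^sub>R (q - p))) has_real_derivative (H_p H x p \<bullet> (q - p))) (at 0)"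
    unfolding has_field_derivative_def
    by (rule has_derivative_eq_rhs) (auto simp: inner_commute mult.commute)
  then have "((\<lambda>c. (H x (p + c *\<^sub>R (q - p)) - H x p) / c) \<longlongrightarrow> H_p H x p \<bullet> (q - p)) (at_right 0)"
    unfolding has_field_derivative_iff by (auto intro: filterlim_mono simp: at_le)
  moreover have "\<forall>\<^sub>F c in at_right 0. (H x (p + c *\<^sub>R (q - p)) - H x p) / c \<le> H x q - H x p"
    unfolding eventually_at_right_field
  proof (intro exI[of _ 1] conjI allI impI)
    fix c :: real assume c: "0 < c" "c < 1"
    have "p + c *\<^sub>R (q - p) = c *\<^sub>R q + (1 - c) *\<^sub>R p" by (simp add: algebra_simps)
    then have "H x (p + c *\<^sub>R (q - p)) \<le> c * H x q + (1 - c) * H x p"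
      using H_strict[OF x _ c, of q p] False by auto
    then show "(H x (p + c *\<^sub>R (q - p)) - H x p) / c \<le> H x q - H x p"
      using c by (simp only: pos_divide_le_eq) (simp add: algebra_simps)
  qed simp
  ultimately have "H_p H x p \<bullet> (q - p) \<le> H x q - H x p"
    by (rule tendsto_upperbound) simp
  then show ?thesis by simp
qed simp

lemma superdiff_H_le_0: "\<lbrakk>x \<in> \<Omega>; p \<in> D x\<rbrakk> \<Longrightarrow> H x p \<le> 0"
  using visc unfolding viscosity_solution_def by blast

text \<open>At a singular point \<open>subdiff\<close> is empty, so the supersolution inequality
  says nothing there directly. It holds for the gradients at nearby points of differentiability and
  passes to their limits.\<close>

lemma extreme_superdiff_H_ge_0:
  assumes "x \<in> \<Omega>"
  shows "\<exists>q\<in>D x. (\<forall>q'\<in>D x. q' \<bullet> n \<le> q \<bullet> n) \<and> H x q \<ge> 0"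
proof -
  obtain q Z Q where q: "q \<in> D x" "\<And>q'. q' \<in> D x \<Longrightarrow> q' \<bullet> n \<le> q \<bullet> n"
    and ZQ: "\<And>k::nat. Z k \<in> \<Omega>" "Z \<longlonglongrightarrow> x" "\<And>k. Q k \<in> D (Z k)" "\<And>k. Q k \<in> subdiff \<Omega> u (Z k)" "Q \<longlonglongrightarrow> q"
    using extreme_reachable_gradient[OF assms, of n] by blast
  have "(\<lambda>k. (\<lambda>(x, p). H x p) (Z k, Q k)) \<longlonglongrightarrow> (\<lambda>(x, p). H x p) (x, q)"
    by (rule continuous_on_tendsto_compose[OF continuous_H])
      (use ZQ assms in \<open>auto intro: tendsto_Pair\<close>)
  moreover have "H (Z k) (Q k) \<ge> 0" for k
    using visc ZQ unfolding viscosity_solution_def by blast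
  ultimately have "H x q \<ge> 0" by (auto intro: LIMSEQ_le_const)
  with q show ?thesis by blast
qed

section \<open>The momentum of least energy\<close>

definition min_momentum :: "'a \<Rightarrow> 'a" where
  "min_momentum x = (SOME p. p \<in> D x \<and> (\<forall>q\<in>D x. H x p \<le> H x q))"

abbreviation velocity :: "'a \<Rightarrow> 'a" where
  "velocity x \<equiv> H_p H x (min_momentum x)"

lemma
  assumes x: "x \<in> \<Omega>"
  shows min_momentum_in: "min_momentum x \<in> D x"
    and min_momentum_le: "q \<in> D x \<Longrightarrow> H x (min_momentum x) \<le> H x q"
proof -
  have "\<exists>p\<in>D x. \<forall>q\<in>D x. H x p \<le> H x q"
    by (rule continuous_attains_inf[OF compact_superdiff[OF x] superdiff_nonempty[OF x]])
      (intro continuous_intros x)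
  then have "\<exists>p. p \<in> D x \<and> (\<forall>q\<in>D x. H x p \<le> H x q)" by blast
  from someI_ex[OF this] show "min_momentum x \<in> D x" "q \<in> D x \<Longrightarrow> H x (min_momentum x) \<le> H x q"
    unfolding min_momentum_def by blast+
qed

lemma min_momentum_less:
  assumes x: "x \<in> \<Omega>" and q: "q \<in> D x" "q \<noteq> min_momentum x"
  shows "H x (min_momentum x) < H x q"
proof -
  let ?r = "(1/2) *\<^sub>R q + (1 - 1/2) *\<^sub>R min_momentum x"
  have "?r \<in> D x"
    using convexD[OF convex_superdiff q(1) min_momentum_in[OF x], of "1/2" "1/2"] by simp
  then have "H x (min_momentum x) \<le> H x ?r" by (rule min_momentum_le[OF x])
  also have "\<dots> < 1/2 * H x q + (1 - 1/2) * H x (min_momentum x)"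
    by (rule H_strict) (use x q in auto)
  finally show ?thesis by simp
qed

text \<open>The first-order condition for a minimum over a convex set. It places \<open>D x\<close>
  in a half-space with inner normal \<open>velocity x\<close>, which later gives one side of the
  slab.\<close>

lemma min_momentum_variational:
  assumes x: "x \<in> \<Omega>" and q: "q \<in> D x"
  shows "velocity x \<bullet> (q - min_momentum x) \<ge> 0"
proof -
  let ?p = "min_momentum x"
  have "((\<lambda>c. H_p H x (?p + c *\<^sub>R (q - ?p)) \<bullet> (q - ?p)) \<longlongrightarrow> H_p H x (?p + 0 *\<^sub>R (q - ?p)) \<bullet> (q - ?p)) (at 0)"
  proof -
    have "continuous_on UNIV (\<lambda>c::real. H_p H x (?p + c *\<^sub>R (q - ?p)) \<bullet> (q - ?p))"
      by (intro continuous_intros x)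
    then show ?thesis unfolding continuous_on_def by (meson UNIV_I)
  qed
  then have "((\<lambda>c. H_p H x (?p + c *\<^sub>R (q - ?p)) \<bullet> (q - ?p)) \<longlongrightarrow> velocity x \<bullet> (q - ?p)) (at_right 0)"
    by (auto intro: filterlim_mono simp: at_le)
  moreover have "\<forall>\<^sub>F c in at_right 0. H_p H x (?p + c *\<^sub>R (q - ?p)) \<bullet> (q - ?p) \<ge> 0"
    unfolding eventually_at_right_field
  proof (intro exI[of _ 1] conjI allI impI)
    fix c :: real assume c: "0 < c" "c < 1"
    let ?q = "?p + c *\<^sub>R (q - ?p)"
    have "?q = c *\<^sub>R q + (1 - c) *\<^sub>R ?p" by (simp add: algebra_simps)
    then have "?q \<in> D x"
      using convexD[OF convex_superdiff q min_momentum_in[OF x], of c "1 - c"] c by simp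
    then have "H x ?p \<le> H x ?q" by (rule min_momentum_le[OF x])
    \<comment> \<open>The tangent is taken at the intermediate point \<open>?q\<close>: minimality
      of \<open>?p\<close> then gives the sign for every small \<open>c\<close>, and continuity of
      the gradient gives it at \<open>c = 0\<close>.\<close>
    moreover have "H x ?p \<ge> H x ?q + H_p H x ?q \<bullet> (?p - ?q)" by (rule H_above_tangent[OF x])
    ultimately have "c * (H_p H x ?q \<bullet> (q - ?p)) \<ge> 0" by simp
    then show "H_p H x ?q \<bullet> (q - ?p) \<ge> 0" using c by (simp add: zero_le_mult_iff)
  qed simp
  ultimately show ?thesis by (rule tendsto_lowerbound) simp
qed

text \<open>On \<open>D x\<close> the excess \<open>H x q - H x (min_momentum x)\<close> is positive away from
  \<open>min_momentum x\<close>, so a large multiple of it dominates \<open>g\<close>; the estimate spreads to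
  nearby points by upper semicontinuity of the superdifferential.\<close>

lemma excess_controls:
  assumes x: "x \<in> \<Omega>" and g: "continuous_on (\<Omega> \<times> UNIV) (\<lambda>(x, p). g x p)"
    and g0: "g x (min_momentum x) \<le> 0" and eta: "\<eta> > 0"
  obtains K r where "K \<ge> 0" "r > 0" "ball x r \<subseteq> \<Omega>"
    "\<And>y q. \<lbrakk>y \<in> ball x r; q \<in> D y\<rbrakk> \<Longrightarrow> g y q < \<eta> + K * (H y q - H y (min_momentum x))"
proof -
  let ?p = "min_momentum x"
  have gx: "continuous_on S (g x)" for S
    using continuous_on_compose2[OF g, of S "\<lambda>q. (x, q)"] x by (simp add: continuous_on_Pair image_subset_iff)
  obtain d where d: "d > 0" "\<And>q. dist q ?p < d \<Longrightarrow> g x q < \<eta>"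
  proof -
    have "isCont (g x) ?p" using gx[of UNIV] by (simp add: continuous_on_eq_continuous_at)
    then have "\<forall>\<^sub>F q in nhds ?p. g x q < \<eta>"
      using order_tendstoD(2)[of "g x" "g x ?p" "nhds ?p" \<eta>] g0 eta
      by (simp add: isCont_def tendsto_at_iff_tendsto_nhds)
    then show ?thesis using that unfolding eventually_nhds_metric by blast
  qed
  have "\<exists>K\<ge>0. \<forall>q\<in>D x. g x q < \<eta> + K * (H x q - H x ?p)"
  proof (cases "D x - ball ?p d = {}")
    case True
    then show ?thesis using d by (intro exI[of _ 0]) (auto simp: dist_commute)
  next
    case False
    have comp: "compact (D x - ball ?p d)" by (intro compact_diff compact_superdiff x) auto
    obtain qm where qm: "qm \<in> D x - ball ?p d" "\<And>q. q \<in> D x - ball ?p d \<Longrightarrow> H x qm \<le> H x q"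
      using continuous_attains_inf[OF comp False
          continuous_H_compose[OF continuous_on_const continuous_on_id], of x] x
      by auto
    obtain qM where qM: "\<And>q. q \<in> D x - ball ?p d \<Longrightarrow> g x q \<le> g x qM"
      using continuous_attains_sup[OF comp False gx] by blast
    define m where "m = H x qm - H x ?p"
    have "qm \<in> D x" "qm \<noteq> ?p" using qm(1) d(1) by auto
    then have m: "m > 0" using min_momentum_less[OF x] by (simp add: m_def)
    \<comment> \<open>Outside the ball \<open>m\<close> is the least excess and
      \<open>g x qM\<close> the largest rate, so \<open>K * m\<close> covers the rate there; inside
      the ball \<open>\<eta>\<close> already does.\<close>
    define K where "K = \<bar>g x qM\<bar> / m"
    have K: "K \<ge> 0" using m by (simp add: K_def)
    have "g x q < \<eta> + K * (H x q - H x ?p)" if q: "q \<in> D x" for q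
    proof (cases "q \<in> ball ?p d")
      case True
      then have "g x q < \<eta>" using d(2) by (simp add: dist_commute)
      moreover have "K * (H x q - H x ?p) \<ge> 0"
        using K min_momentum_le[OF x q] by simp
      ultimately show ?thesis by linarith
    next
      case False
      then have "g x q \<le> \<bar>g x qM\<bar>" using qM[of q] q by simp
      also have "\<bar>g x qM\<bar> = K * m" using m by (simp add: K_def)
      also have "\<dots> \<le> K * (H x q - H x ?p)"
        using qm(2)[of q] q False K by (intro mult_left_mono) (auto simp: m_def)
      finally show ?thesis using eta by linarith
    qed
    then show ?thesis using K by blast
  qed
  then obtain K where K: "K \<ge> 0" "\<And>q. q \<in> D x \<Longrightarrow> g x q < \<eta> + K * (H x q - H x ?p)" by blast
  \<comment> \<open>The comparison momentum stays frozen at \<open>?p\<close> while \<open>y\<close>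
    moves, which keeps \<open>G\<close> continuous; \<open>min_momentum y\<close> need not depend
    continuously on \<open>y\<close>.\<close>
  define G where "G y q = \<eta> + K * (H y q - H y ?p) - g y q" for y q
  have "continuous_on (\<Omega> \<times> UNIV) (\<lambda>z. \<eta> + K * (H (fst z) (snd z) - H (fst z) ?p) - (\<lambda>(x, p). g x p) z)"
    by (intro continuous_intros g) auto
  then have "continuous_on (\<Omega> \<times> UNIV) (\<lambda>(y, q). G y q)"
    by (simp add: G_def case_prod_unfold)
  moreover have "G x q > 0" if "q \<in> D x" for q using K(2)[OF that] by (simp add: G_def)
  ultimately obtain r where "r > 0" "ball x r \<subseteq> \<Omega>" "\<And>y q. \<lbrakk>y \<in> ball x r; q \<in> D y\<rbrakk> \<Longrightarrow> G y q > 0"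
    using superdiff_tube[OF x, of G] by blast
  then show ?thesis using K(1) by (intro that[of K r]) (auto simp: G_def)
qed

section \<open>One-sided estimates along characteristics\<close>

definition characteristic :: "real \<Rightarrow> (real \<Rightarrow> 'a) \<Rightarrow> (real \<Rightarrow> 'a) \<Rightarrow> bool" where
  "characteristic T \<xi> p \<longleftrightarrow> (\<exists>L. L-lipschitz_on {0..T} \<xi>) \<and>
     (\<forall>t\<in>{0..T}. \<xi> t \<in> \<Omega> \<and> p t \<in> D (\<xi> t)) \<and>
     (\<exists>N\<in>null_sets lebesgue. \<forall>t\<in>{0..T} - N.
        (\<xi> has_vector_derivative H_p H (\<xi> t) (p t)) (at t within {0..T}))"

text \<open>The function \<open>u (\<xi> s) - p\<^sub>0 \<bullet> \<xi> s\<close>, where \<open>p\<^sub>0 = min_momentum (\<xi> t0)\<close>, grows at least at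
  the rate \<open>H (\<xi> s) (p s) - H (\<xi> s) p\<^sub>0\<close>, while semiconcavity bounds its growth from \<open>t0\<close> by
  \<open>O((t - t0)\<^sup>2)\<close>. Hence the excess, and with it every rate \<open>g\<close> that it controls, is small on
  average near \<open>t0\<close>.\<close>

lemma characteristic_small_rates:
  assumes chr: "characteristic T \<xi> p" and t0: "0 \<le> t0" "t0 < T"
    and g: "continuous_on (\<Omega> \<times> UNIV) (\<lambda>(x, p). g x p)"
    and g0: "g (\<xi> t0) (min_momentum (\<xi> t0)) \<le> 0" and eta: "\<eta> > 0"
  shows "\<exists>d>0. \<exists>N\<in>null_sets lebesgue.
    (\<forall>s\<in>{0..T} - N. (\<xi> has_vector_derivative H_p H (\<xi> s) (p s)) (at s within {0..T})) \<and>
    (\<forall>F t. t \<in> {t0..T} \<longrightarrow> t \<le> t0 + d \<longrightarrow> (\<exists>L. L-lipschitz_on {0..T} F) \<longrightarrow>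
       (\<forall>s\<in>{t0<..t} - N. \<forall>e>0. \<forall>\<^sub>F h in at_right 0. F s - F (s - h) \<le> (g (\<xi> s) (p s) + e) * h)
       \<longrightarrow> F t - F t0 \<le> \<eta> * (t - t0))"
proof -
  obtain L0 where L0: "L0-lipschitz_on {0..T} \<xi>" using chr unfolding characteristic_def by blast
  have dom: "\<xi> t \<in> \<Omega>" "p t \<in> D (\<xi> t)" if "t \<in> {0..T}" for t
    using chr that unfolding characteristic_def by blast+
  obtain N where N: "N \<in> null_sets lebesgue"
    and der: "\<And>s. s \<in> {0..T} - N \<Longrightarrow> (\<xi> has_vector_derivative H_p H (\<xi> s) (p s)) (at s within {0..T})"
    using chr unfolding characteristic_def by blast
  have L0nn: "L0 \<ge> 0" using L0 by (rule lipschitz_on_nonneg)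
  have lip: "norm (\<xi> s - \<xi> r) \<le> L0 * \<bar>s - r\<bar>" if "s \<in> {0..T}" "r \<in> {0..T}" for s r
    using lipschitz_onD[OF L0 that] by (simp add: dist_norm)
  define x0 where "x0 = \<xi> t0"
  define p0 where "p0 = min_momentum x0"
  have x0: "x0 \<in> \<Omega>" using dom t0 by (simp add: x0_def)
  have p0: "p0 \<in> D x0" using min_momentum_in[OF x0] by (simp add: p0_def)
  obtain K r where K: "K \<ge> 0" and r: "r > 0" "ball x0 r \<subseteq> \<Omega>"
    and Kr: "\<And>y q. \<lbrakk>y \<in> ball x0 r; q \<in> D y\<rbrakk> \<Longrightarrow> g y q < \<eta>/2 + K * (H y q - H y p0)"
    using excess_controls[OF x0 g, of "\<eta>/2"] g0 eta unfolding x0_def p0_def by auto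
  obtain r1 M where r1: "r1 > 0" "\<And>y q. \<lbrakk>y \<in> ball x0 r1; q \<in> D y\<rbrakk> \<Longrightarrow> norm q \<le> M"
    using superdiff_locally_bounded[OF x0] by metis
  define r2 where "r2 = min r r1"
  have r2: "r2 > 0" using r r1 by (simp add: r2_def)
  have sub: "ball x0 r2 \<subseteq> \<Omega>" "ball x0 r2 \<subseteq> ball x0 r" "ball x0 r2 \<subseteq> ball x0 r1"
    using r by (auto simp: r2_def)
  \<comment> \<open>The first entry keeps the curve in the ball of radius \<open>r2\<close>; the
    second makes the quadratic growth bound, multiplied by \<open>K\<close>, at most
    \<open>\<eta> / 2 * (t - t0)\<close>.\<close>
  define d where "d = min (r2 / (2 * (L0 + 1))) (\<eta> / (K * C * L0\<^sup>2 + 1))"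
  have den: "K * C * L0\<^sup>2 + 1 > 0" using K C_pos by (simp add: add_nonneg_pos)
  have d: "d > 0" using r2 L0nn den eta by (simp add: d_def)
  have dr: "L0 * d < r2"
  proof -
    have "L0 * d \<le> L0 * (r2 / (2 * (L0 + 1)))" by (intro mult_left_mono L0nn) (simp add: d_def)
    also have "\<dots> = L0 * r2 / (2 * (L0 + 1))" by simp
    also have "\<dots> < r2"
    proof (subst pos_divide_less_eq)
      have "L0 * r2 \<ge> 0" using L0nn r2 by simp
      then show "L0 * r2 < r2 * (2 * (L0 + 1))" using r2 by (simp add: algebra_simps)
    qed (use L0nn in simp)
    finally show ?thesis .
  qed
  have dK: "K * (C / 2 * L0\<^sup>2) * d \<le> \<eta> / 2"
  proof -
    have "K * C * L0\<^sup>2 * d \<le> (K * C * L0\<^sup>2 + 1) * d" using d by simp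
    also have "\<dots> \<le> (K * C * L0\<^sup>2 + 1) * (\<eta> / (K * C * L0\<^sup>2 + 1))"
      using den by (intro mult_left_mono) (auto simp: d_def)
    also have "\<dots> = \<eta>" using den by simp
    finally show ?thesis by simp
  qed
  have inball: "\<xi> s \<in> ball x0 r2" if "s \<in> {t0..T}" "s \<le> t0 + d" for s
  proof -
    have "norm (\<xi> s - x0) \<le> L0 * \<bar>s - t0\<bar>" unfolding x0_def using that t0 by (intro lip) auto
    also have "\<dots> \<le> L0 * d" using that by (intro mult_left_mono L0nn) auto
    also have "\<dots> < r2" by (rule dr)
    finally show ?thesis by (simp add: dist_norm norm_minus_commute)
  qed
  \<comment> \<open>The upper bound based at the later point \<open>\<xi> s\<close> controls the
    earlier value, hence the increment from below. An increment starting at \<open>s\<close> would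
    be controlled only from above; this is why left increments are used.\<close>
  have u_increment: "u (\<xi> s) - u (\<xi> s') \<ge> p s \<bullet> (\<xi> s - \<xi> s') - C / 2 * L0\<^sup>2 * (s - s')\<^sup>2"
    if "s \<in> {t0..T}" "s \<le> t0 + d" "s' \<in> {t0..s}" for s s'
  proof -
    have "closed_segment (\<xi> s) (\<xi> s') \<subseteq> \<Omega>"
      using that inball by (intro segment_in_ball[OF sub(1)]) auto
    moreover have "p s \<in> D (\<xi> s)" "\<xi> s \<in> \<Omega>" using that t0 by (auto intro!: dom)
    ultimately have "u (\<xi> s') \<le> u (\<xi> s) + p s \<bullet> (\<xi> s' - \<xi> s) + C / 2 * (norm (\<xi> s' - \<xi> s))\<^sup>2"
      by (intro superdiff_upper_bound)
    moreover have "(norm (\<xi> s' - \<xi> s))\<^sup>2 \<le> (L0 * \<bar>s' - s\<bar>)\<^sup>2"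
      using that t0 by (intro power_mono lip) auto
    then have "C / 2 * (norm (\<xi> s' - \<xi> s))\<^sup>2 \<le> C / 2 * (L0\<^sup>2 * (s - s')\<^sup>2)"
      using C_pos by (intro mult_left_mono) (auto simp: power_mult_distrib power2_commute)
    ultimately show ?thesis by (simp add: inner_diff_right)
  qed
  show ?thesis
  proof (intro exI[of _ d] bexI[OF _ N] conjI ballI allI impI d der; (assumption)?)
    fix F :: "real \<Rightarrow> real" and t
    assume t: "t \<in> {t0..T}" "t \<le> t0 + d" and "\<exists>L. L-lipschitz_on {0..T} F"
      and dini: "\<forall>s\<in>{t0<..t} - N. \<forall>e>0.
          \<forall>\<^sub>F h in at_right 0. F s - F (s - h) \<le> (g (\<xi> s) (p s) + e) * h"
    then obtain L where LF: "L-lipschitz_on {0..T} F" by blast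
    \<comment> \<open>\<open>F\<close> stands in for the integral of the rate \<open>g\<close>. By
      the choice of \<open>K\<close>, the rate of \<open>f\<close> is nonnegative almost everywhere,
      so the growth of \<open>F\<close> is charged to that of
      \<open>u (\<xi> s) - p0 \<bullet> \<xi> s\<close>.\<close>
    define f where "f s = K * (u (\<xi> s) - p0 \<bullet> \<xi> s) + \<eta> / 2 * s - F s" for s
    have "f t0 \<le> f t"
    proof (rule nondecreasing_from_left_Dini_ae[where f = f and a = t0 and b = t, OF _ _ N])
      show "t0 \<le> t" using t by simp
      have "continuous_on {t0..t} \<xi>" "continuous_on {t0..t} F"
        using t t0 by (auto intro!: continuous_on_subset[OF lipschitz_on_continuous_on[OF L0]]
            continuous_on_subset[OF lipschitz_on_continuous_on[OF LF]])
      then show "continuous_on {t0..t} f" unfolding f_def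
        using t t0 dom by (intro continuous_intros continuous_on_compose2[OF continuous_u]) auto
      \<comment> \<open>A crude bound that holds at all times, including the exceptional null set;
        only the finiteness of its constant matters.\<close>
      show "f s - f s' \<ge> - (K * (M * L0 + C / 2 * L0\<^sup>2 * T) + K * (norm p0 * L0) + L) * (s - s')"
        if s: "t0 \<le> s'" "s' \<le> s" "s \<le> t" for s s'
      proof -
        have l: "norm (\<xi> s - \<xi> s') \<le> L0 * (s - s')" using lip[of s s'] s t t0 by auto
        have "\<xi> s \<in> ball x0 r1" using s t inball[of s] sub(3) by auto
        then have nM: "norm (p s) \<le> M" by (rule r1(2)) (use s t t0 dom in auto)
        then have "norm (p s) * norm (\<xi> s - \<xi> s') \<le> M * (L0 * (s - s'))"
          by (intro mult_mono l nM) (auto intro: order_trans[OF norm_ge_zero nM])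
        then have 1: "p s \<bullet> (\<xi> s - \<xi> s') \<ge> - (M * L0 * (s - s'))"
          using Cauchy_Schwarz_ineq2[of "p s" "\<xi> s - \<xi> s'"] by (simp add: abs_le_iff algebra_simps)
        have "(s - s')\<^sup>2 \<le> T * (s - s')"
          unfolding power2_eq_square using s t t0 by (intro mult_right_mono) auto
        then have "C / 2 * L0\<^sup>2 * (s - s')\<^sup>2 \<le> C / 2 * L0\<^sup>2 * (T * (s - s'))"
          using C_pos by (intro mult_left_mono) auto
        then have "u (\<xi> s) - u (\<xi> s') \<ge> - ((M * L0 + C / 2 * L0\<^sup>2 * T) * (s - s'))"
          using u_increment[of s s'] 1 s t by (simp add: distrib_right mult.assoc)
        then have A: "K * (u (\<xi> s) - u (\<xi> s')) \<ge> K * (- ((M * L0 + C / 2 * L0\<^sup>2 * T) * (s - s')))"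
          using K by (intro mult_left_mono)
        have "norm p0 * norm (\<xi> s - \<xi> s') \<le> norm p0 * (L0 * (s - s'))"
          by (intro mult_left_mono l) auto
        then have "p0 \<bullet> (\<xi> s - \<xi> s') \<le> norm p0 * L0 * (s - s')"
          using Cauchy_Schwarz_ineq2[of p0 "\<xi> s - \<xi> s'"] by (simp add: abs_le_iff)
        then have B: "K * (p0 \<bullet> (\<xi> s - \<xi> s')) \<le> K * (norm p0 * L0 * (s - s'))"
          using K by (intro mult_left_mono)
        have "dist (F s) (F s') \<le> L * dist s s'" using lipschitz_onD[OF LF, of s s'] s t t0 by auto
        then have F: "F s - F s' \<le> L * (s - s')" using s by (simp add: dist_real_def)
        have "\<eta> / 2 * (s - s') \<ge> 0" using eta s by simp
        then show ?thesis using A B F by (simp add: f_def algebra_simps)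
      qed
    next
      fix s e :: real assume s: "s \<in> {t0<..t} - N" and e: "e > 0"
      have s': "s \<in> {0<..T}" "s \<in> {0..T} - N" "s \<in> {0..T}" "s \<in> {t0..T}" "s \<le> t0 + d"
        using s t t0 by auto
      define v where "v = H_p H (\<xi> s) (p s)"
      define A where "A = K * norm (p s - p0)"
      have A: "A \<ge> 0" using K by (simp add: A_def)
      \<comment> \<open>Of the allowed error \<open>e * h\<close>, a quarter each goes to the
        derivative of \<open>\<xi>\<close>, to the increment of \<open>F\<close> and to the
        quadratic term.\<close>
      define e1 where "e1 = e / (4 * (A + 1))"
      have e1: "e1 > 0" using e A by (simp add: e1_def)
      have Ae1: "A * e1 \<le> e / 4" using e A by (simp add: e1_def field_simps)
      define B where "B = K * (C / 2 * L0\<^sup>2)"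
      have B: "B \<ge> 0" using K C_pos by (simp add: B_def)
      have ev1: "\<forall>\<^sub>F h in at_right 0. norm (\<xi> s - \<xi> (s - h) - h *\<^sub>R v) \<le> e1 * h"
        unfolding v_def by (rule has_vector_derivative_left_increment[OF der[OF s'(2)] s'(1) e1])
      have ev2: "\<forall>\<^sub>F h in at_right 0. F s - F (s - h) \<le> (g (\<xi> s) (p s) + e / 4) * h"
        using bspec[OF dini s] e by simp
      have ev3: "\<forall>\<^sub>F h in at_right 0. h \<in> {0<..<min (s - t0) (e / (4 * (B + 1)))}"
        using s e B by (intro eventually_at_right_real) simp
      have "\<forall>\<^sub>F h in at_right 0. h > 0 \<and> t0 \<le> s - h \<and> f s - f (s - h) \<ge> - e * h"
        using ev1 ev2 ev3
      proof eventually_elim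
        case (elim h)
        have h: "h > 0" "t0 \<le> s - h" "h < e / (4 * (B + 1))" using elim(3) by auto
        have "B * h \<le> (B + 1) * h" using h by simp
        also have "\<dots> \<le> e / 4" using h B by (simp add: field_simps)
        finally have Bh: "B * h * h \<le> e / 4 * h" using h by (intro mult_right_mono) auto
        let ?\<Delta> = "\<xi> s - \<xi> (s - h)"
        \<comment> \<open>\<open>(p s - p0) \<bullet> v\<close> is the first-order growth of
          \<open>u (\<xi> s) - p0 \<bullet> \<xi> s\<close>; convexity bounds it below by the
          excess.\<close>
        have tan: "(p s - p0) \<bullet> v \<ge> H (\<xi> s) (p s) - H (\<xi> s) p0"
          using H_above_tangent[OF dom(1)[OF s'(3)], of "p s" p0]
          by (simp add: v_def inner_commute inner_diff_right inner_diff_left)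
        have "\<bar>(p s - p0) \<bullet> (?\<Delta> - h *\<^sub>R v)\<bar> \<le> norm (p s - p0) * (e1 * h)"
          by (rule order_trans[OF Cauchy_Schwarz_ineq2]) (intro mult_left_mono elim(1) norm_ge_zero)
        then have "(p s - p0) \<bullet> ?\<Delta> \<ge> h * ((p s - p0) \<bullet> v) - norm (p s - p0) * (e1 * h)"
          by (simp add: inner_diff_right abs_le_iff)
        moreover have "h * ((p s - p0) \<bullet> v) \<ge> h * (H (\<xi> s) (p s) - H (\<xi> s) p0)"
          using tan h by (intro mult_left_mono) auto
        ultimately have "(p s - p0) \<bullet> ?\<Delta>
            \<ge> h * (H (\<xi> s) (p s) - H (\<xi> s) p0) - norm (p s - p0) * (e1 * h)" by linarith
        moreover have "u (\<xi> s) - u (\<xi> (s - h)) \<ge> p s \<bullet> ?\<Delta> - C / 2 * L0\<^sup>2 * h\<^sup>2"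
          using u_increment[OF s'(4,5), of "s - h"] h by auto
        ultimately have "u (\<xi> s) - u (\<xi> (s - h)) - p0 \<bullet> ?\<Delta> \<ge>
            h * (H (\<xi> s) (p s) - H (\<xi> s) p0) - norm (p s - p0) * (e1 * h) - C / 2 * L0\<^sup>2 * h\<^sup>2"
          by (simp add: inner_diff_left)
        then have "K * (u (\<xi> s) - u (\<xi> (s - h)) - p0 \<bullet> ?\<Delta>) \<ge>
            K * (h * (H (\<xi> s) (p s) - H (\<xi> s) p0) - norm (p s - p0) * (e1 * h) - C / 2 * L0\<^sup>2 * h\<^sup>2)"
          using K by (intro mult_left_mono)
        also have "K * (h * (H (\<xi> s) (p s) - H (\<xi> s) p0) - norm (p s - p0) * (e1 * h) - C / 2 * L0\<^sup>2 * h\<^sup>2)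
            = K * (H (\<xi> s) (p s) - H (\<xi> s) p0) * h - A * e1 * h - B * h * h"
          by (simp add: A_def B_def right_diff_distrib left_diff_distrib power2_eq_square mult_ac)
        finally have X: "K * (u (\<xi> s) - u (\<xi> (s - h)) - p0 \<bullet> ?\<Delta>) \<ge>
            K * (H (\<xi> s) (p s) - H (\<xi> s) p0) * h - A * e1 * h - B * h * h" .
        have "A * e1 * h \<le> e / 4 * h" using Ae1 h by (intro mult_right_mono) auto
        moreover have "g (\<xi> s) (p s) * h \<le> (\<eta> / 2 + K * (H (\<xi> s) (p s) - H (\<xi> s) p0)) * h"
          using Kr[of "\<xi> s" "p s"] inball[OF s'(4,5)] sub dom(2)[OF s'(3)] h
          by (intro mult_right_mono) auto
        moreover have "f s - f (s - h) = K * (u (\<xi> s) - u (\<xi> (s - h)) - p0 \<bullet> ?\<Delta>)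
            + \<eta> / 2 * h - (F s - F (s - h))"
          by (simp add: f_def algebra_simps diff_divide_distrib)
        moreover have "(g (\<xi> s) (p s) + e / 4) * h = g (\<xi> s) (p s) * h + e / 4 * h"
          "(\<eta> / 2 + K * (H (\<xi> s) (p s) - H (\<xi> s) p0)) * h
             = \<eta> / 2 * h + K * (H (\<xi> s) (p s) - H (\<xi> s) p0) * h"
          by (simp_all add: distrib_right)
        moreover have "e * h > 0" using e h by simp
        ultimately have "f s - f (s - h) \<ge> - e * h"
          using X Bh elim(2) by linarith
        then show ?case using h by simp
      qed
      then have "\<exists>h. h > 0 \<and> t0 \<le> s - h \<and> f s - f (s - h) \<ge> - e * h"
        using eventually_happens'[OF trivial_limit_at_right_real] by blast
      then show "\<exists>h>0. t0 \<le> s - h \<and> f s - f (s - h) \<ge> - e * h" by simp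
    qed
    moreover have "u (\<xi> t) \<le> u x0 + p0 \<bullet> (\<xi> t - x0) + C / 2 * L0\<^sup>2 * (t - t0)\<^sup>2"
    proof -
      have "closed_segment x0 (\<xi> t) \<subseteq> \<Omega>"
        using inball[OF t] r2 by (intro segment_in_ball[OF sub(1)]) auto
      then have "u (\<xi> t) \<le> u x0 + p0 \<bullet> (\<xi> t - x0) + C / 2 * (norm (\<xi> t - x0))\<^sup>2"
        by (intro superdiff_upper_bound p0 x0)
      moreover have "(norm (\<xi> t - x0))\<^sup>2 \<le> (L0 * \<bar>t - t0\<bar>)\<^sup>2"
        unfolding x0_def using t t0 by (intro power_mono lip) auto
      then have "C / 2 * (norm (\<xi> t - x0))\<^sup>2 \<le> C / 2 * (L0\<^sup>2 * (t - t0)\<^sup>2)"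
        using C_pos by (intro mult_left_mono) (auto simp: power_mult_distrib)
      ultimately show ?thesis by simp
    qed
    then have "K * (u (\<xi> t) - u x0 - p0 \<bullet> (\<xi> t - x0)) \<le> K * (C / 2 * L0\<^sup>2 * (t - t0)\<^sup>2)"
      using K by (intro mult_left_mono) auto
    moreover have "K * (C / 2 * L0\<^sup>2 * (t - t0)\<^sup>2) \<le> \<eta> / 2 * (t - t0)"
    proof -
      have "K * (C / 2 * L0\<^sup>2) * (t - t0) \<le> K * (C / 2 * L0\<^sup>2) * d"
        using t K C_pos by (intro mult_left_mono) auto
      then have "K * (C / 2 * L0\<^sup>2) * (t - t0) * (t - t0) \<le> \<eta> / 2 * (t - t0)"
        using dK t by (intro mult_right_mono) auto
      then show ?thesis by (simp add: power2_eq_square mult.assoc)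
    qed
    ultimately show "F t - F t0 \<le> \<eta> * (t - t0)"
      by (simp add: f_def x0_def algebra_simps diff_divide_distrib)
  qed
qed

text \<open>The rate \<open>norm (H_p H y q - V)\<close> vanishes at the minimizing momentum, so
  \<open>characteristic_small_rates\<close> makes the deviation from uniform motion
  \<open>o(t - t0)\<close>.\<close>

lemma characteristic_right_derivative:
  assumes chr: "characteristic T \<xi> p" and t0: "0 \<le> t0" "t0 < T" and eta: "\<eta> > 0"
  obtains d where "d > 0" "\<And>t. \<lbrakk>t \<in> {t0..T}; t \<le> t0 + d\<rbrakk> \<Longrightarrow>
      norm (\<xi> t - \<xi> t0 - (t - t0) *\<^sub>R velocity (\<xi> t0)) \<le> \<eta> * (t - t0)"
proof -
  define V where "V = velocity (\<xi> t0)"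
  obtain L0 where L0: "L0-lipschitz_on {0..T} \<xi>" using chr unfolding characteristic_def by blast
  have "continuous_on (\<Omega> \<times> UNIV) (\<lambda>z. norm (H_p H (fst z) (snd z) - V))"
    by (intro continuous_intros) auto
  then have g: "continuous_on (\<Omega> \<times> UNIV) (\<lambda>(y, q). norm (H_p H y q - V))"
    by (simp add: case_prod_unfold)
  have g0: "norm (velocity (\<xi> t0) - V) \<le> 0" by (simp add: V_def)
  obtain d N where d: "d > 0" and der: "\<forall>s\<in>{0..T} - N. (\<xi> has_vector_derivative H_p H (\<xi> s) (p s)) (at s within {0..T})"
    and small: "\<forall>F t. t \<in> {t0..T} \<longrightarrow> t \<le> t0 + d \<longrightarrow> (\<exists>L. L-lipschitz_on {0..T} F) \<longrightarrow>
       (\<forall>s\<in>{t0<..t} - N. \<forall>e>0. \<forall>\<^sub>F h in at_right 0. F s - F (s - h) \<le> (norm (H_p H (\<xi> s) (p s) - V) + e) * h)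
       \<longrightarrow> F t - F t0 \<le> \<eta> * (t - t0)"
    using characteristic_small_rates[OF chr t0 g g0 eta] by blast
  show ?thesis
  proof (rule that[OF d])
    fix t assume t: "t \<in> {t0..T}" "t \<le> t0 + d"
    \<comment> \<open>The deviation is measured along its own direction at the final time. This
      direction depends on \<open>t\<close>, which is harmless because \<open>d\<close> is chosen
      before the test function \<open>F\<close>.\<close>
    define w where "w = sgn (\<xi> t - \<xi> t0 - (t - t0) *\<^sub>R V)"
    have w: "norm w \<le> 1" by (simp add: w_def norm_sgn)
    define F where "F s = w \<bullet> (\<xi> s - s *\<^sub>R V)" for s
    have "F t - F t0 \<le> \<eta> * (t - t0)"
    proof (rule small[rule_format, OF t])
      have "(L0 + norm V)-lipschitz_on {0..T} F"
      proof (rule lipschitz_onI)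
        fix a b assume ab: "a \<in> {0..T}" "b \<in> {0..T}"
        have "dist (F a) (F b) = \<bar>w \<bullet> (\<xi> a - \<xi> b - (a - b) *\<^sub>R V)\<bar>"
          by (simp add: F_def dist_real_def algebra_simps)
        also have "\<dots> \<le> 1 * norm (\<xi> a - \<xi> b - (a - b) *\<^sub>R V)"
          by (rule order_trans[OF Cauchy_Schwarz_ineq2]) (intro mult_right_mono w norm_ge_zero)
        also have "\<dots> \<le> norm (\<xi> a - \<xi> b) + norm ((a - b) *\<^sub>R V)"
          by (simp only: mult_1) (rule norm_triangle_ineq4)
        also have "\<dots> \<le> L0 * \<bar>a - b\<bar> + \<bar>a - b\<bar> * norm V"
          using lipschitz_onD[OF L0 ab] by (simp add: dist_norm)
        finally show "dist (F a) (F b) \<le> (L0 + norm V) * dist a b"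
          by (simp add: dist_real_def algebra_simps)
      qed (use lipschitz_on_nonneg[OF L0] in simp)
      then show "\<exists>L. L-lipschitz_on {0..T} F" ..
      fix s e :: real assume s: "s \<in> {t0<..t} - N" and e: "e > 0"
      let ?v = "H_p H (\<xi> s) (p s)"
      have "\<forall>\<^sub>F h in at_right 0. norm (\<xi> s - \<xi> (s - h) - h *\<^sub>R ?v) \<le> e * h"
        by (rule has_vector_derivative_left_increment[OF der[rule_format] _ e]) (use s t t0 in auto)
      then show "\<forall>\<^sub>F h in at_right 0. F s - F (s - h) \<le> (norm (?v - V) + e) * h"
        using eventually_at_right_less[of 0]
      proof eventually_elim
        case (elim h)
        have "F s - F (s - h) = w \<bullet> ((\<xi> s - \<xi> (s - h) - h *\<^sub>R ?v) + h *\<^sub>R (?v - V))"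
          by (simp add: F_def algebra_simps)
        also have "\<dots> \<le> 1 * norm ((\<xi> s - \<xi> (s - h) - h *\<^sub>R ?v) + h *\<^sub>R (?v - V))"
          by (rule order_trans[OF norm_cauchy_schwarz]) (intro mult_right_mono w norm_ge_zero)
        also have "\<dots> \<le> e * h + h * norm (?v - V)"
          using norm_triangle_ineq[of "\<xi> s - \<xi> (s - h) - h *\<^sub>R ?v" "h *\<^sub>R (?v - V)"] elim by simp
        finally show ?case by (simp add: algebra_simps)
      qed
    qed
    moreover have "F t - F t0 = norm (\<xi> t - \<xi> t0 - (t - t0) *\<^sub>R V)"
    proof -
      have sgn: "sgn x \<bullet> x = norm x" for x :: 'a
        by (cases "x = 0") (simp_all add: sgn_div_norm dot_square_norm power2_eq_square)
      have "F t - F t0 = w \<bullet> (\<xi> t - \<xi> t0 - (t - t0) *\<^sub>R V)"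
        by (simp add: F_def algebra_simps)
      also have "\<dots> = norm (\<xi> t - \<xi> t0 - (t - t0) *\<^sub>R V)"
        unfolding w_def by (rule sgn)
      finally show ?thesis .
    qed
    ultimately show "norm (\<xi> t - \<xi> t0 - (t - t0) *\<^sub>R velocity (\<xi> t0)) \<le> \<eta> * (t - t0)"
      by (simp add: V_def)
  qed
qed

text \<open>If all momenta in the window were at distance at least \<open>\<delta>\<close>, the
  function \<open>\<delta> * s\<close> would be an admissible test function for the rate
  \<open>norm (q - p0)\<close> and would grow twice as fast as allowed.\<close>

lemma characteristic_momentum_near_min:
  assumes chr: "characteristic T \<xi> p" and t0: "0 \<le> t0" "t0 < T" and "\<delta> > 0" "d0 > 0"
  shows "\<exists>s\<in>{t0<..T}. s < t0 + d0 \<and> norm (p s - min_momentum (\<xi> t0)) < \<delta>"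
proof (rule ccontr)
  assume contr: "\<not> ?thesis"
  define p0 where "p0 = min_momentum (\<xi> t0)"
  have "continuous_on (\<Omega> \<times> UNIV) (\<lambda>z. norm (snd z - p0))"
    by (intro continuous_intros)
  then have g: "continuous_on (\<Omega> \<times> UNIV) (\<lambda>(y::'a, q). norm (q - p0))"
    by (simp add: case_prod_unfold)
  have g0: "norm (min_momentum (\<xi> t0) - p0) \<le> 0" by (simp add: p0_def)
  have \<delta>2: "\<delta> / 2 > 0" using \<open>\<delta> > 0\<close> by simp
  obtain d N where d: "d > 0" and small: "\<forall>F t. t \<in> {t0..T} \<longrightarrow> t \<le> t0 + d \<longrightarrow> (\<exists>L. L-lipschitz_on {0..T} F) \<longrightarrow>
       (\<forall>s\<in>{t0<..t} - N. \<forall>e>0. \<forall>\<^sub>F h in at_right 0. F s - F (s - h) \<le> (norm (p s - p0) + e) * h)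
       \<longrightarrow> F t - F t0 \<le> \<delta> / 2 * (t - t0)"
    using characteristic_small_rates[OF chr t0 g g0 \<delta>2] by blast
  define t where "t = min T (t0 + min d (d0 / 2))"
  have t: "t \<in> {t0<..T}" "t \<le> t0 + d" "t < t0 + d0"
    using d t0 \<open>d0 > 0\<close> by (auto simp: t_def)
  have "\<delta> * t - \<delta> * t0 \<le> \<delta> / 2 * (t - t0)"
  proof (rule small[rule_format, of t "(*) \<delta>"])
    have "\<bar>\<delta>\<bar>-lipschitz_on {0..T} ((*) \<delta>)"
      by (rule lipschitz_onI) (auto simp: dist_real_def abs_mult simp flip: right_diff_distrib)
    then show "\<exists>L. L-lipschitz_on {0..T} ((*) \<delta>)" ..
    fix s e :: real assume s: "s \<in> {t0<..t} - N" and e: "e > 0"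
    have "norm (p s - p0) \<ge> \<delta>" using contr s t by (force simp: p0_def not_less)
    then have "\<delta> * h \<le> (norm (p s - p0) + e) * h" if "h > 0" for h
      using e that by (intro mult_right_mono) auto
    then show "\<forall>\<^sub>F h in at_right 0. \<delta> * s - \<delta> * (s - h) \<le> (norm (p s - p0) + e) * h"
      using eventually_at_right_less[of 0] by (auto elim!: eventually_mono simp: algebra_simps)
  qed (use t in auto)
  then have "\<delta> * (t - t0) \<le> 0" by (simp add: algebra_simps)
  then show False using t \<open>\<delta> > 0\<close> by (simp add: mult_le_0_iff)
qed

end

section \<open>Noncritical singular points in the plane\<close>

text \<open>The assumption \<open>planar\<close> says that \<open>n\<close> spans the orthogonal complement of the velocity
  at \<open>x0\<close>; this is how dimension two enters.\<close>

locale noncritical_singular_point = semiconcave_viscosity_solution \<Omega> u C H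
  for \<Omega> :: "'a::euclidean_space set" and u C H +
  fixes x0 n :: 'a
  assumes x0: "x0 \<in> \<Omega>" and singular: "\<exists>q\<in>D x0. q \<noteq> min_momentum x0"
    and noncritical: "velocity x0 \<noteq> 0"
    and unit_normal: "norm n = 1" "velocity x0 \<bullet> n = 0"
    and planar: "\<And>w. w = (w \<bullet> n) *\<^sub>R n + (w \<bullet> velocity x0 / (norm (velocity x0))\<^sup>2) *\<^sub>R velocity x0"
begin

definition "p0 = min_momentum x0"
definition "v0 = velocity x0"

lemma p0: "p0 \<in> D x0" unfolding p0_def by (rule min_momentum_in[OF x0])

lemma v0: "v0 = H_p H x0 p0" "norm v0 > 0"
  using noncritical by (simp_all add: v0_def p0_def)

lemma norm_le_components: "norm w \<le> \<bar>w \<bullet> n\<bar> + \<bar>w \<bullet> v0\<bar> / norm v0"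
proof -
  have "norm w \<le> norm ((w \<bullet> n) *\<^sub>R n) + norm ((w \<bullet> v0 / (norm v0)\<^sup>2) *\<^sub>R v0)"
    using planar[of w] unfolding v0_def by (metis norm_triangle_ineq)
  also have "\<dots> = \<bar>w \<bullet> n\<bar> + \<bar>w \<bullet> v0\<bar> / norm v0"
    using unit_normal v0(2) by (simp add: abs_divide power2_eq_square)
  finally show ?thesis .
qed

text \<open>Singularity of \<open>x0\<close> enters here: a second element of \<open>D x0\<close>
  has \<open>H\<close> at most 0 and strictly above the minimum.\<close>

lemma H_x0_p0_neg: "H x0 p0 < 0"
proof -
  obtain q where "q \<in> D x0" "q \<noteq> min_momentum x0" using singular by blast
  then show ?thesis using min_momentum_less[OF x0] superdiff_H_le_0[OF x0] unfolding p0_def by fastforce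
qed

section \<open>Shape of the superdifferentials near the singular point\<close>

definition slab :: "real \<Rightarrow> 'a \<Rightarrow> bool" where
  "slab \<delta> x \<longleftrightarrow> (\<forall>q\<in>D x. \<bar>(q - p0) \<bullet> v0\<bar> \<le> \<delta>)"

definition near_p0 :: "real \<Rightarrow> 'a \<Rightarrow> bool" where
  "near_p0 r x \<longleftrightarrow> (\<exists>q\<in>D x. norm (q - p0) \<le> r)"

definition spread :: "real \<Rightarrow> 'a \<Rightarrow> bool" where
  "spread \<eta> x \<longleftrightarrow> (\<exists>q\<in>D x. (q - p0) \<bullet> n \<ge> \<eta>) \<and> (\<exists>q\<in>D x. (q - p0) \<bullet> n \<le> - \<eta>)"

lemma nhd_of_continuous:
  fixes g :: "'a \<Rightarrow> 'a \<Rightarrow> real"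
  assumes g: "continuous_on (\<Omega> \<times> UNIV) (\<lambda>(x, p). g x p)" and "g x0 p0 > 0"
  obtains \<rho> where "\<rho> > 0" "ball x0 \<rho> \<subseteq> \<Omega>"
    "\<And>x q. \<lbrakk>x \<in> ball x0 \<rho>; norm (q - p0) < \<rho>\<rbrakk> \<Longrightarrow> g x q > 0"
proof -
  have "open (\<Omega> \<times> (UNIV :: 'a set))" by (intro open_Times open_dom) simp
  then have op: "open ((\<lambda>(x, p). g x p) -` {0<..} \<inter> (\<Omega> \<times> UNIV))"
    using continuous_open_preimage[OF g, of "{0<..}"] by (simp add: Int_commute)
  moreover have "(x0, p0) \<in> (\<lambda>(x, p). g x p) -` {0<..} \<inter> (\<Omega> \<times> UNIV)" using assms x0 by simp
  ultimately obtain e where e: "e > 0"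
      "ball (x0, p0) e \<subseteq> (\<lambda>(x, p). g x p) -` {0<..} \<inter> (\<Omega> \<times> UNIV)"
    by (meson open_contains_ball)
  have in_ball: "(x, q) \<in> ball (x0, p0) e" if "x \<in> ball x0 (e/2)" "norm (q - p0) < e/2" for x q
  proof -
    have "dist (x0, p0) (x, q) \<le> dist x0 x + dist p0 q"
      by (simp add: dist_prod_def sqrt_sum_squares_le_sum)
    also have "\<dots> < e" using that by (simp add: dist_norm norm_minus_commute)
    finally show ?thesis by simp
  qed
  show ?thesis
  proof (rule that[of "e/2"])
    show "ball x0 (e/2) \<subseteq> \<Omega>"
    proof
      fix x assume "x \<in> ball x0 (e/2)"
      then have "(x, p0) \<in> ball (x0, p0) e" using e(1) by (intro in_ball) auto
      then show "x \<in> \<Omega>" using e(2) by blast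
    qed
    show "g x q > 0" if "x \<in> ball x0 (e/2)" "norm (q - p0) < e/2" for x q
      using subsetD[OF e(2) in_ball[OF that]] by simp
  qed (use e in simp)
qed

text \<open>The extreme points of \<open>D x\<close> in the directions \<open>n\<close> and \<open>- n\<close> satisfy \<open>H = 0\<close>, so they
  stay away from \<open>p0\<close>, where \<open>H < 0\<close>.\<close>

lemma near_p0_imp_spread:
  obtains \<eta> \<rho> where "\<eta> > 0" "\<rho> > 0" "ball x0 \<rho> \<subseteq> \<Omega>"
    "\<And>x. \<lbrakk>x \<in> ball x0 \<rho>; slab (\<eta> * norm v0) x; near_p0 \<eta> x\<rbrakk> \<Longrightarrow> spread \<eta> x"
proof -
  have "continuous_on (\<Omega> \<times> UNIV) (\<lambda>z. - H (fst z) (snd z))" by (intro continuous_intros) auto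
  then have "continuous_on (\<Omega> \<times> UNIV) (\<lambda>(x, p). - H x p)" by (simp add: case_prod_unfold)
  from nhd_of_continuous[OF this] H_x0_p0_neg
  obtain \<rho> where \<rho>: "\<rho> > 0" "ball x0 \<rho> \<subseteq> \<Omega>"
    "\<And>x q. \<lbrakk>x \<in> ball x0 \<rho>; norm (q - p0) < \<rho>\<rbrakk> \<Longrightarrow> - H x q > 0" by auto
  \<comment> \<open>An extreme point is at distance at least \<open>4 * \<eta>\<close> from
    \<open>p0\<close>. The slab accounts for one \<open>\<eta>\<close>, leaving
    \<open>3 * \<eta>\<close> along \<open>n\<close>; a point of \<open>D x\<close> within
    \<open>\<eta>\<close> of \<open>p0\<close> then decides the sign.\<close>
  define \<eta> where "\<eta> = \<rho> / 4"
  have extreme: "\<exists>q\<in>D x. (q - p0) \<bullet> m \<ge> \<eta>"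
    if x: "x \<in> ball x0 \<rho>" "slab (\<eta> * norm v0) x" "near_p0 \<eta> x" and m: "m = n \<or> m = - n" for x m
  proof -
    have xO: "x \<in> \<Omega>" using x \<rho> by blast
    obtain q where q: "q \<in> D x" "\<And>q'. q' \<in> D x \<Longrightarrow> q' \<bullet> m \<le> q \<bullet> m" "H x q \<ge> 0"
      using extreme_superdiff_H_ge_0[OF xO, of m] by blast
    obtain q' where q': "q' \<in> D x" "norm (q' - p0) \<le> \<eta>" using x(3) unfolding near_p0_def by blast
    have nm: "norm m = 1" "\<bar>w \<bullet> m\<bar> = \<bar>w \<bullet> n\<bar>" for w using m unit_normal by auto
    have "\<not> norm (q - p0) < \<rho>" using \<rho>(3)[OF x(1), of q] q(3) by auto
    moreover have "\<bar>(q - p0) \<bullet> v0\<bar> / norm v0 \<le> \<eta>"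
      using x(2) q(1) v0(2) unfolding slab_def by (simp add: pos_divide_le_eq)
    ultimately have "\<bar>(q - p0) \<bullet> m\<bar> \<ge> 3 * \<eta>"
      using norm_le_components[of "q - p0"] unfolding nm(2) \<eta>_def by linarith
    moreover have "\<bar>(q' - p0) \<bullet> m\<bar> \<le> \<eta>"
      using Cauchy_Schwarz_ineq2[of "q' - p0" m] q'(2) by (simp add: nm(1))
    then have "(q - p0) \<bullet> m \<ge> - \<eta>"
      using q(2)[OF q'(1)] by (simp add: inner_diff_left abs_le_iff)
    moreover have "\<eta> > 0" using \<rho>(1) by (simp add: \<eta>_def)
    ultimately have "(q - p0) \<bullet> m \<ge> \<eta>" by linarith
    then show ?thesis using q(1) by blast
  qed
  show ?thesis
  proof (rule that[of \<eta> \<rho>])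
    show "spread \<eta> x" if x: "x \<in> ball x0 \<rho>" "slab (\<eta> * norm v0) x" "near_p0 \<eta> x" for x
      unfolding spread_def
    proof
      show "\<exists>q\<in>D x. (q - p0) \<bullet> n \<ge> \<eta>" using extreme[OF x, of n] by simp
      obtain q where "q \<in> D x" "(q - p0) \<bullet> (- n) \<ge> \<eta>" using extreme[OF x, of "- n"] by blast
      then show "\<exists>q\<in>D x. (q - p0) \<bullet> n \<le> - \<eta>" by (intro bexI[of _ q]) auto
    qed
  qed (use \<rho> in \<open>auto simp: \<eta>_def\<close>)
qed

text \<open>A convex combination of the two spread points has no component along \<open>n\<close>,
  so in the slab it lies near \<open>p0\<close>. Hence the minimum of \<open>H x\<close> on
  \<open>D x\<close> is hardly above \<open>H x p0\<close>, and \<open>excess_controls\<close> turns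
  this into a distance.\<close>

lemma spread_imp_min_momentum_near:
  assumes "\<epsilon> > 0"
  obtains \<delta> \<rho> where "\<delta> > 0" "\<rho> > 0" "ball x0 \<rho> \<subseteq> \<Omega>"
    "\<And>x \<eta>. \<lbrakk>x \<in> ball x0 \<rho>; slab \<delta> x; spread \<eta> x; \<eta> > 0\<rbrakk> \<Longrightarrow> norm (min_momentum x - p0) < \<epsilon>"
proof -
  have "continuous_on (\<Omega> \<times> UNIV) (\<lambda>z. norm (snd z - p0))" by (intro continuous_intros)
  then have g: "continuous_on (\<Omega> \<times> UNIV) (\<lambda>(y::'a, q). norm (q - p0))"
    by (simp add: case_prod_unfold)
  obtain K r where K: "K \<ge> 0" and r: "r > 0" "ball x0 r \<subseteq> \<Omega>"
    and Kr: "\<And>y q. \<lbrakk>y \<in> ball x0 r; q \<in> D y\<rbrakk> \<Longrightarrow> norm (q - p0) < \<epsilon> / 2 + K * (H y q - H y p0)"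
    using excess_controls[OF x0 g, of "\<epsilon> / 2"] assms unfolding p0_def by auto
  define a where "a = \<epsilon> / 2 / (K + 1)"
  have a: "a > 0" using assms K by (simp add: a_def)
  have "K * a \<le> (K + 1) * a" using a by simp
  also have "\<dots> = \<epsilon> / 2"
  proof -
    have cancel: "k * (\<epsilon> / 2 / k) = \<epsilon> / 2" if "k \<noteq> 0" for k :: real using that by simp
    show ?thesis unfolding a_def by (rule cancel) (use K in simp)
  qed
  finally have Ka: "K * a \<le> \<epsilon> / 2" .
  have "continuous_on (\<Omega> \<times> UNIV) (\<lambda>z. a - (H (fst z) (snd z) - H (fst z) p0))"
    by (intro continuous_intros) auto
  then have "continuous_on (\<Omega> \<times> UNIV) (\<lambda>(x, p). a - (H x p - H x p0))"
    by (simp add: case_prod_unfold)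
  from nhd_of_continuous[OF this] a
  obtain \<rho> where \<rho>: "\<rho> > 0" "ball x0 \<rho> \<subseteq> \<Omega>"
    "\<And>x q. \<lbrakk>x \<in> ball x0 \<rho>; norm (q - p0) < \<rho>\<rbrakk> \<Longrightarrow> a - (H x q - H x p0) > 0" by auto
  define \<delta> where "\<delta> = \<rho> / 2 * norm v0"
  show ?thesis
  proof (rule that[of \<delta> "min r \<rho>"])
    fix x \<eta> assume x: "x \<in> ball x0 (min r \<rho>)" "slab \<delta> x" "spread \<eta> x" and \<eta>: "\<eta> > (0::real)"
    have xr: "x \<in> ball x0 r" "x \<in> ball x0 \<rho>" "x \<in> \<Omega>" using x(1) r by auto
    obtain q1 q2 where q: "q1 \<in> D x" "(q1 - p0) \<bullet> n \<ge> \<eta>" "q2 \<in> D x" "(q2 - p0) \<bullet> n \<le> - \<eta>"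
      using x(3) unfolding spread_def by blast
    define b1 where "b1 = (q1 - p0) \<bullet> n"
    define b2 where "b2 = - ((q2 - p0) \<bullet> n)"
    have b: "b1 > 0" "b2 > 0" using q \<eta> by (simp_all add: b1_def b2_def)
    define q3 where "q3 = (b2 / (b1 + b2)) *\<^sub>R q1 + (b1 / (b1 + b2)) *\<^sub>R q2"
    have c: "b2 / (b1 + b2) + b1 / (b1 + b2) = 1" using b by (simp add: add_divide_distrib[symmetric])
    have q3: "q3 \<in> D x" unfolding q3_def
      using b c by (intro convexD[OF convex_superdiff q(1,3)]) auto
    have "q3 - p0 = (b2 / (b1 + b2)) *\<^sub>R (q1 - p0) + (b1 / (b1 + b2)) *\<^sub>R (q2 - p0)"
    proof -
      have "(b2 / (b1 + b2)) *\<^sub>R (q1 - p0) + (b1 / (b1 + b2)) *\<^sub>R (q2 - p0)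
          = q3 - (b2 / (b1 + b2) + b1 / (b1 + b2)) *\<^sub>R p0"
        unfolding q3_def scaleR_diff_right scaleR_add_left by simp
      then show ?thesis unfolding c by simp
    qed
    then have "(q3 - p0) \<bullet> n = (b2 / (b1 + b2)) * b1 + (b1 / (b1 + b2)) * (- b2)"
      by (simp only: inner_add_left inner_scaleR_left b1_def b2_def minus_minus)
    then have "(q3 - p0) \<bullet> n = 0" by simp
    then have "norm (q3 - p0) \<le> \<bar>(q3 - p0) \<bullet> v0\<bar> / norm v0" using norm_le_components[of "q3 - p0"] by simp
    also have "\<dots> \<le> \<rho> / 2"
      using x(2) q3 v0(2) unfolding slab_def by (simp add: pos_divide_le_eq \<delta>_def)
    finally have "norm (q3 - p0) < \<rho>" using \<rho>(1) by simp
    then have "H x q3 - H x p0 < a" using \<rho>(3)[OF xr(2), of q3] by simp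
    moreover have "H x (min_momentum x) \<le> H x q3" by (rule min_momentum_le[OF xr(3) q3])
    ultimately have "K * (H x (min_momentum x) - H x p0) \<le> K * a"
      using K by (intro mult_left_mono) auto
    then show "norm (min_momentum x - p0) < \<epsilon>"
      using Kr[OF xr(1) min_momentum_in[OF xr(3)]] Ka by simp
  qed (use \<rho> r v0(2) in \<open>auto simp: \<delta>_def\<close>)
qed

text \<open>The lower bound is upper semicontinuity, since \<open>p0\<close> minimizes \<open>H x0\<close> on \<open>D x0\<close>; the upper
  bound is the almost monotonicity of the superdifferential along \<open>\<xi> t - x0 = t v0 + o(t)\<close>.\<close>

lemma characteristic_slab:
  assumes chr: "characteristic T \<xi> p" "\<xi> 0 = x0" "0 < T" and "\<delta> > 0"
  obtains d where "d > 0" "\<And>t. \<lbrakk>t \<in> {0<..T}; t \<le> d\<rbrakk> \<Longrightarrow> slab \<delta> (\<xi> t)"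
proof -
  have "continuous_on (\<Omega> \<times> UNIV) (\<lambda>z. (snd z - p0) \<bullet> v0 + \<delta>)" by (intro continuous_intros)
  then have g: "continuous_on (\<Omega> \<times> UNIV) (\<lambda>(y::'a, q). (q - p0) \<bullet> v0 + \<delta>)"
    by (simp add: case_prod_unfold)
  have pos: "(q - p0) \<bullet> v0 + \<delta> > 0" if "q \<in> D x0" for q
    using min_momentum_variational[OF x0 that] \<open>\<delta> > 0\<close>
    by (simp add: p0_def v0_def inner_commute)
  obtain r1 where r1: "r1 > 0" "ball x0 r1 \<subseteq> \<Omega>"
    "\<And>y q. \<lbrakk>y \<in> ball x0 r1; q \<in> D y\<rbrakk> \<Longrightarrow> (q - p0) \<bullet> v0 + \<delta> > 0"
    using superdiff_tube[OF x0 g pos] by blast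
  obtain r2 M where r2: "r2 > 0" "\<And>y q. \<lbrakk>y \<in> ball x0 r2; q \<in> D y\<rbrakk> \<Longrightarrow> norm q \<le> M"
    using superdiff_locally_bounded[OF x0] by metis
  have "norm p0 \<le> M" using r2(1) by (intro r2(2)[OF _ p0]) simp
  then have M: "M \<ge> 0" by (rule order_trans[OF norm_ge_zero])
  define B where "B = M + norm p0 + 1"
  have B: "B > 0" using M by (simp add: B_def add_nonneg_pos)
  \<comment> \<open>\<open>B\<close> bounds \<open>norm (q - p0)\<close>, so the remainder
    \<open>e\<close> below uses half of \<open>\<delta>\<close>; the quadratic term gets the other
    half through \<open>d\<close>. The cap 1 bounds the speed away from \<open>x0\<close> by
    \<open>norm v0 + 1\<close>.\<close>
  define \<eta> where "\<eta> = min 1 (\<delta> / (2 * B))"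
  have \<eta>: "\<eta> > 0" "\<eta> \<le> 1" using B \<open>\<delta> > 0\<close> by (auto simp: \<eta>_def)
  have B\<eta>: "B * \<eta> \<le> \<delta> / 2"
  proof -
    have "B * \<eta> \<le> B * (\<delta> / (2 * B))" using B by (intro mult_left_mono) (auto simp: \<eta>_def)
    then show ?thesis using B by simp
  qed
  define A where "A = (norm v0 + 1)\<^sup>2"
  have A: "A > 0" using v0(2) unfolding A_def by (intro zero_less_power add_pos_pos) auto
  obtain d0 where d0: "d0 > 0" "\<And>t. \<lbrakk>t \<in> {0..T}; t \<le> 0 + d0\<rbrakk> \<Longrightarrow>
      norm (\<xi> t - \<xi> 0 - (t - 0) *\<^sub>R velocity (\<xi> 0)) \<le> \<eta> * (t - 0)"
    using characteristic_right_derivative[OF chr(1) _ chr(3) \<eta>(1)] by auto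
  define r where "r = min r1 r2"
  define d where "d = min d0 (min (r / (2 * (norm v0 + 1))) (\<delta> / (2 * C * A)))"
  have nv: "norm v0 + 1 > 0" by (rule add_nonneg_pos) auto
  have d: "d > 0" using d0 r1 r2 nv A C_pos \<open>\<delta> > 0\<close> by (simp add: d_def r_def)
  show ?thesis
  proof (rule that[OF d])
    fix t assume t: "t \<in> {0<..T}" "t \<le> d"
    define e where "e = \<xi> t - x0 - t *\<^sub>R v0"
    have e: "norm e \<le> \<eta> * t" using d0(2)[of t] t chr(2) by (simp add: e_def v0_def d_def)
    have xt: "\<xi> t - x0 = t *\<^sub>R v0 + e" by (simp add: e_def)
    have "norm e \<le> 1 * t" using e \<eta>(2) t by (meson greaterThanAtMost_iff less_imp_le mult_right_mono order_trans)
    then have nx: "norm (\<xi> t - x0) \<le> (norm v0 + 1) * t"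
      unfolding xt using t norm_triangle_ineq[of "t *\<^sub>R v0" e] by (simp add: algebra_simps)
    have "(norm v0 + 1) * t \<le> (norm v0 + 1) * (r / (2 * (norm v0 + 1)))"
      using t nv by (intro mult_left_mono) (auto simp: d_def)
    also have "\<dots> = r / 2"
    proof -
      have cancel: "k * (r / (2 * k)) = r / 2" if "k \<noteq> 0" for k :: real using that by simp
      show ?thesis by (rule cancel) (use nv in simp)
    qed
    also have "\<dots> < r" using r1(1) r2(1) by (auto simp: r_def min_def)
    finally have xb: "\<xi> t \<in> ball x0 r" using nx by (simp add: dist_norm norm_minus_commute)
    have xO: "\<xi> t \<in> \<Omega>" using xb r1 by (auto simp: r_def)
    show "slab \<delta> (\<xi> t)" unfolding slab_def
    proof
      fix q assume q: "q \<in> D (\<xi> t)"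
      have "(q - p0) \<bullet> v0 + \<delta> > 0" using r1(3)[OF _ q] xb by (simp add: r_def)
      moreover have "(q - p0) \<bullet> v0 \<le> \<delta>"
      proof -
        have "closed_segment (\<xi> t) x0 \<subseteq> \<Omega>"
          by (rule segment_in_ball[OF r1(2)]) (use xb r1 in \<open>auto simp: r_def\<close>)
        then have "(q - p0) \<bullet> (\<xi> t - x0) \<le> C * (norm (\<xi> t - x0))\<^sup>2"
          by (intro superdiff_almost_monotone q p0 xO x0)
        also have "\<dots> \<le> C * ((norm v0 + 1) * t)\<^sup>2"
          using C_pos nx by (intro mult_left_mono power_mono) auto
        also have "\<dots> = C * A * t * t" by (simp add: A_def power_mult_distrib power2_eq_square)
        also have "\<dots> \<le> \<delta> / 2 * t"
        proof (rule mult_right_mono)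
          have "C * A * t \<le> C * A * (\<delta> / (2 * C * A))"
            using t A C_pos by (intro mult_left_mono) (auto simp: d_def)
          then show "C * A * t \<le> \<delta> / 2" using A C_pos by simp
        qed (use t in simp)
        finally have 1: "(q - p0) \<bullet> (\<xi> t - x0) \<le> \<delta> / 2 * t" .
        have "norm q \<le> M" by (rule r2(2)[OF _ q]) (use xb in \<open>simp add: r_def\<close>)
        then have "norm (q - p0) \<le> B" using norm_triangle_ineq4[of q p0] by (simp add: B_def)
        then have "norm (q - p0) * norm e \<le> B * (\<eta> * t)"
          using e B by (intro mult_mono) auto
        also have "\<dots> \<le> \<delta> / 2 * t" using B\<eta> t by (simp add: mult.assoc[symmetric])
        finally have "- ((q - p0) \<bullet> e) \<le> \<delta> / 2 * t"
          using Cauchy_Schwarz_ineq2[of "q - p0" e] by (simp add: abs_le_iff)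
        moreover have "(q - p0) \<bullet> (\<xi> t - x0) = t * ((q - p0) \<bullet> v0) + (q - p0) \<bullet> e"
          by (simp add: xt inner_add_right)
        ultimately have "t * ((q - p0) \<bullet> v0) \<le> t * \<delta>" using 1 by (simp add: mult.commute)
        then show ?thesis using t by simp
      qed
      ultimately show "\<bar>(q - p0) \<bullet> v0\<bar> \<le> \<delta>" by simp
    qed
  qed
qed

lemma closed_near_p0:
  assumes "X \<longlonglongrightarrow> x" "x \<in> \<Omega>" "\<And>k::nat. near_p0 r (X k)"
  shows "near_p0 r x"
proof -
  obtain P where P: "\<And>k. P k \<in> D (X k)" "\<And>k. norm (P k - p0) \<le> r"
    using assms(3) unfolding near_p0_def by metis
  obtain p s where s: "p \<in> D x" "strict_mono s" "(P \<circ> s) \<longlonglongrightarrow> p"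
    using superdiff_subsequence[OF assms(2,1) P(1)] by blast
  have "(\<lambda>k. norm ((P \<circ> s) k - p0)) \<longlonglongrightarrow> norm (p - p0)" by (intro tendsto_intros s(3))
  then have "norm (p - p0) \<le> r" by (rule LIMSEQ_le_const2) (simp add: P(2))
  then show ?thesis using s(1) unfolding near_p0_def by blast
qed

text \<open>The set of times at which \<open>D (\<xi> t)\<close> meets the \<open>\<eta>\<close>-ball around \<open>p0\<close> is closed, contains
  \<open>0\<close>, and by \<open>characteristic_momentum_near_min\<close> none of its points is isolated from the right.\<close>

lemma characteristic_window:
  "\<exists>\<eta>>0. \<forall>T \<xi> p \<rho>. characteristic T \<xi> p \<longrightarrow> \<xi> 0 = x0 \<longrightarrow> 0 < T \<longrightarrow> \<rho> > 0 \<longrightarrow>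
     (\<exists>\<tau>\<in>{0<..T}. \<forall>t\<in>{0..\<tau>}. \<xi> t \<in> ball x0 \<rho> \<and> velocity (\<xi> t) \<bullet> v0 > (norm v0)\<^sup>2 / 2
        \<and> (t > 0 \<longrightarrow> spread \<eta> (\<xi> t)))"
proof -
  obtain \<eta> \<rho>1 where \<eta>: "\<eta> > 0" and \<rho>1: "\<rho>1 > 0" "ball x0 \<rho>1 \<subseteq> \<Omega>"
    "\<And>x. \<lbrakk>x \<in> ball x0 \<rho>1; slab (\<eta> * norm v0) x; near_p0 \<eta> x\<rbrakk> \<Longrightarrow> spread \<eta> x"
    using near_p0_imp_spread by blast
  have "continuous_on (\<Omega> \<times> UNIV) (\<lambda>z. H_p H (fst z) (snd z) \<bullet> v0 - (norm v0)\<^sup>2 / 2)"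
    by (intro continuous_intros) auto
  then have "continuous_on (\<Omega> \<times> UNIV) (\<lambda>(x, p). H_p H x p \<bullet> v0 - (norm v0)\<^sup>2 / 2)"
    by (simp add: case_prod_unfold)
  from nhd_of_continuous[OF this] v0
  obtain \<rho>2 where \<rho>2: "\<rho>2 > 0" "ball x0 \<rho>2 \<subseteq> \<Omega>"
    "\<And>x q. \<lbrakk>x \<in> ball x0 \<rho>2; norm (q - p0) < \<rho>2\<rbrakk> \<Longrightarrow> H_p H x q \<bullet> v0 - (norm v0)\<^sup>2 / 2 > 0"
    by (auto simp: dot_square_norm)
  \<comment> \<open>With the minimizing momentum within \<open>\<eta> / 2\<close> of
    \<open>p0\<close>, a momentum within \<open>\<eta> / 2\<close> of it still lies in the
    \<open>\<eta>\<close>-ball; this closes the continuation argument.\<close>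
  define \<epsilon> where "\<epsilon> = min \<rho>2 (\<eta> / 2)"
  have \<epsilon>: "\<epsilon> > 0" using \<eta> \<rho>2 by (simp add: \<epsilon>_def)
  obtain \<delta> \<rho>3 where \<delta>: "\<delta> > 0" and \<rho>3: "\<rho>3 > 0" "ball x0 \<rho>3 \<subseteq> \<Omega>"
    "\<And>x \<eta>. \<lbrakk>x \<in> ball x0 \<rho>3; slab \<delta> x; spread \<eta> x; \<eta> > 0\<rbrakk> \<Longrightarrow> norm (min_momentum x - p0) < \<epsilon>"
    using spread_imp_min_momentum_near[OF \<epsilon>] by blast
  \<comment> \<open>\<open>\<eta>\<close> is fixed before the curve, since both characteristics must
    share it.\<close>
  show ?thesis
  proof (intro exI[of _ \<eta>] conjI allI impI \<eta>)
    fix T \<rho> :: real and \<xi> p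
    assume chr: "characteristic T \<xi> p" "\<xi> 0 = x0" "0 < T" and \<rho>: "\<rho> > 0"
    define \<delta>' where "\<delta>' = min \<delta> (\<eta> * norm v0)"
    have "\<delta>' > 0" using \<delta> \<eta> v0 by (simp add: \<delta>'_def)
    then obtain d1 where d1: "d1 > 0" "\<And>t. \<lbrakk>t \<in> {0<..T}; t \<le> d1\<rbrakk> \<Longrightarrow> slab \<delta>' (\<xi> t)"
      using characteristic_slab[OF chr] by blast
    define R where "R = min \<rho> (min \<rho>1 (min \<rho>2 \<rho>3))"
    have R: "R > 0" using \<rho> \<rho>1 \<rho>2 \<rho>3 by (simp add: R_def)
    obtain L where L: "L-lipschitz_on {0..T} \<xi>" using chr(1) unfolding characteristic_def by blast
    have cont: "continuous_on {0..T} \<xi>" by (rule lipschitz_on_continuous_on[OF L])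
    obtain d2 where d2: "d2 > 0" "\<And>t. \<lbrakk>t \<in> {0..T}; t < d2\<rbrakk> \<Longrightarrow> \<xi> t \<in> ball x0 R"
    proof -
      obtain d where "d > 0" "\<forall>t\<in>{0..T}. dist t 0 < d \<longrightarrow> dist (\<xi> t) (\<xi> 0) < R"
        using cont[unfolded continuous_on_iff, rule_format, of 0 R] R chr(3) by auto
      then show ?thesis using chr(2) by (intro that[of d]) (auto simp: dist_commute dist_real_def)
    qed
    define \<tau> where "\<tau> = min T (min d1 (d2 / 2))"
    have \<tau>: "\<tau> \<in> {0<..T}" "\<tau> \<le> d1" "\<tau> < d2" using d1 d2 chr(3) by (auto simp: \<tau>_def)
    have inR: "\<xi> t \<in> ball x0 R" if "t \<in> {0..\<tau>}" for t using d2(2)[of t] that \<tau> by auto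
    have dom: "\<xi> t \<in> \<Omega>" "p t \<in> D (\<xi> t)" if "t \<in> {0..\<tau>}" for t
      using chr(1) that \<tau> unfolding characteristic_def by auto
    have sl: "slab \<delta> (\<xi> t)" "slab (\<eta> * norm v0) (\<xi> t)" if "t \<in> {0<..\<tau>}" for t
      using d1(2)[of t] that \<tau> unfolding slab_def \<delta>'_def by force+
    have sp: "spread \<eta> (\<xi> t)" if "t \<in> {0<..\<tau>}" "near_p0 \<eta> (\<xi> t)" for t
      using \<rho>1(3)[OF _ sl(2) that(2)] inR[of t] that(1) by (auto simp: R_def)
    \<comment> \<open>Time 0 is separate: \<open>D x0\<close> itself may reach far in the direction
      \<open>v0\<close>, so the slab is available only for positive times.\<close>
    have mm: "norm (min_momentum (\<xi> t) - p0) < \<epsilon>" if "t \<in> {0..\<tau>}" "near_p0 \<eta> (\<xi> t)" for t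
    proof (cases "t = 0")
      case True
      then show ?thesis using chr(2) \<epsilon> by (simp add: p0_def)
    next
      case False
      then have "t \<in> {0<..\<tau>}" using that by auto
      then show ?thesis using \<rho>3(3)[OF _ sl(1) sp[OF _ that(2)] \<eta>] inR[OF that(1)] by (auto simp: R_def)
    qed
    have good: "near_p0 \<eta> (\<xi> t)" if t: "t \<in> {0..\<tau>}" for t
    proof (rule ccontr)
      assume not: "\<not> near_p0 \<eta> (\<xi> t)"
      define S where "S = {s \<in> {0..t}. near_p0 \<eta> (\<xi> s)}"
      have "0 \<in> S" using t p0 \<eta> chr(2) unfolding S_def near_p0_def by force
      have "closed S" unfolding closed_sequential_limits
      proof (intro allI impI)
        fix X l assume X: "(\<forall>k. X k \<in> S) \<and> X \<longlonglongrightarrow> l"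
        have "l \<in> {0..t}"
          by (rule closed_sequentially[of "{0..t}" X]) (use X in \<open>auto simp: S_def\<close>)
        moreover have "(\<lambda>k. \<xi> (X k)) \<longlonglongrightarrow> \<xi> l"
        proof (rule continuous_on_tendsto_compose[OF cont])
          have "X k \<in> {0..T}" for k using conjunct1[OF X, rule_format, of k] t \<tau> by (auto simp: S_def)
          then show "\<forall>\<^sub>F k in sequentially. X k \<in> {0..T}" by simp
        qed (use X t \<tau> \<open>l \<in> {0..t}\<close> in auto)
        then have "near_p0 \<eta> (\<xi> l)"
          by (rule closed_near_p0) (use X t dom \<open>l \<in> {0..t}\<close> in \<open>auto simp: S_def\<close>)
        ultimately show "l \<in> S" by (simp add: S_def)
      qed
      moreover have bdd: "bdd_above S" by (rule bdd_aboveI[of _ t]) (simp add: S_def)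
      ultimately have sup: "Sup S \<in> S" using closed_contains_Sup[of S] \<open>0 \<in> S\<close> by blast
      define s where "s = Sup S"
      have s: "s \<in> {0..t}" "near_p0 \<eta> (\<xi> s)" using sup by (auto simp: S_def s_def)
      then have "s < t" using not by (cases "s = t") auto
      have "\<exists>r\<in>{s<..T}. r < s + (t - s) \<and> norm (p r - min_momentum (\<xi> s)) < \<eta> / 2"
        using s t \<tau> \<open>s < t\<close> \<eta> by (intro characteristic_momentum_near_min[OF chr(1)]) auto
      then obtain r where r: "s < r" "r < t" "norm (p r - min_momentum (\<xi> s)) < \<eta> / 2" by auto
      have "norm (min_momentum (\<xi> s) - p0) < \<eta> / 2" using mm[of s] s t by (simp add: \<epsilon>_def)
      then have "norm (p r - p0) \<le> \<eta>"
        using r(3) norm_triangle_ineq[of "p r - min_momentum (\<xi> s)" "min_momentum (\<xi> s) - p0"] by simp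
      then have "r \<in> S" using dom[of r] r s t unfolding S_def near_p0_def by auto
      then have "r \<le> s" unfolding s_def by (rule cSup_upper[OF _ bdd])
      with r show False by simp
    qed
    show "\<exists>\<tau>\<in>{0<..T}. \<forall>t\<in>{0..\<tau>}. \<xi> t \<in> ball x0 \<rho> \<and> velocity (\<xi> t) \<bullet> v0 > (norm v0)\<^sup>2 / 2
          \<and> (t > 0 \<longrightarrow> spread \<eta> (\<xi> t))"
    proof (intro bexI[of _ \<tau>] ballI conjI impI)
      fix t assume t: "t \<in> {0..\<tau>}"
      show "\<xi> t \<in> ball x0 \<rho>" using inR[OF t] by (simp add: R_def)
      show "velocity (\<xi> t) \<bullet> v0 > (norm v0)\<^sup>2 / 2"
        using \<rho>2(3)[of "\<xi> t" "min_momentum (\<xi> t)"] inR[OF t] mm[OF t good[OF t]]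
        by (simp add: R_def \<epsilon>_def)
      show "spread \<eta> (\<xi> t)" if "t > 0" using sp good[OF t] t that by simp
    qed (rule \<tau>)
  qed
qed

text \<open>The difference is \<open>a *\<^sub>R n\<close>. Pairing the end of \<open>D x\<close> on
  the side of the sign of \<open>a\<close> with the opposite end of \<open>D y\<close> gives a
  product of at least \<open>2 * \<eta> * \<bar>a\<bar>\<close>, while almost monotonicity allows at
  most \<open>C * a\<^sup>2\<close>, and \<open>\<bar>a\<bar> < 2 * \<rho>\<close>.\<close>

lemma spread_points_graph:
  assumes sub: "ball x0 \<rho> \<subseteq> \<Omega>" and \<rho>: "C * \<rho> \<le> \<eta>" and "\<eta> > 0"
    and x: "x \<in> ball x0 \<rho>" "spread \<eta> x" and y: "y \<in> ball x0 \<rho>" "spread \<eta> y"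
    and eq: "x \<bullet> v0 = y \<bullet> v0"
  shows "x = y"
proof (rule ccontr)
  assume "x \<noteq> y"
  define a where "a = (x - y) \<bullet> n"
  have xy: "x - y = a *\<^sub>R n"
  proof -
    have "(x - y) \<bullet> v0 = 0" using eq by (simp add: inner_diff_left)
    moreover have "x - y = ((x - y) \<bullet> n) *\<^sub>R n + ((x - y) \<bullet> v0 / (norm v0)\<^sup>2) *\<^sub>R v0"
      unfolding v0_def by (rule planar)
    ultimately show ?thesis by (metis a_def add_0_right div_0 scaleR_zero_left)
  qed
  have "a \<noteq> 0" using xy \<open>x \<noteq> y\<close> by auto
  have na: "norm (x - y) = \<bar>a\<bar>" using xy unit_normal by simp
  have "norm (x - y) < 2 * \<rho>"
    using x y dist_triangle_half_r[of x0 x "2 * \<rho>" y] by (simp add: dist_norm)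
  then have "C * \<bar>a\<bar> < C * (2 * \<rho>)" using na C_pos by simp
  then have Ca: "C * \<bar>a\<bar> < 2 * \<eta>" using \<rho> by simp
  have "\<exists>p\<in>D x. \<exists>q\<in>D y. a * ((p - q) \<bullet> n) \<ge> \<bar>a\<bar> * (2 * \<eta>)"
  proof (cases "a > 0")
    case True
    obtain p q where pq: "p \<in> D x" "(p - p0) \<bullet> n \<ge> \<eta>" "q \<in> D y" "(q - p0) \<bullet> n \<le> - \<eta>"
      using x y unfolding spread_def by blast
    have "(p - q) \<bullet> n \<ge> 2 * \<eta>" using pq by (simp add: inner_diff_left)
    then show ?thesis using pq True by (intro bexI[of _ p] bexI[of _ q]) auto
  next
    case False
    obtain p q where pq: "p \<in> D x" "(p - p0) \<bullet> n \<le> - \<eta>" "q \<in> D y" "(q - p0) \<bullet> n \<ge> \<eta>"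
      using x y unfolding spread_def by blast
    have "- ((p - q) \<bullet> n) \<ge> 2 * \<eta>" using pq by (simp add: inner_diff_left)
    then have "(- a) * (- ((p - q) \<bullet> n)) \<ge> (- a) * (2 * \<eta>)" using False by (intro mult_left_mono) auto
    then show ?thesis using pq False by (intro bexI[of _ p] bexI[of _ q]) auto
  qed
  then obtain p q where pq: "p \<in> D x" "q \<in> D y" "a * ((p - q) \<bullet> n) \<ge> \<bar>a\<bar> * (2 * \<eta>)" by blast
  have "(p - q) \<bullet> (x - y) \<le> C * (norm (x - y))\<^sup>2"
    using x y sub by (intro superdiff_almost_monotone pq segment_in_ball[OF sub]) auto
  moreover have "(p - q) \<bullet> (x - y) = a * ((p - q) \<bullet> n)" by (simp add: xy)
  moreover have "C * (norm (x - y))\<^sup>2 = \<bar>a\<bar> * (C * \<bar>a\<bar>)" by (simp add: na power2_eq_square)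
  ultimately have "\<bar>a\<bar> * (2 * \<eta>) \<le> \<bar>a\<bar> * (C * \<bar>a\<bar>)" using pq(3) by linarith
  then show False using Ca \<open>a \<noteq> 0\<close> by simp
qed

end

text \<open>The reparametrization \<open>\<phi> = \<zeta>2\<inverse> \<circ> \<zeta>1\<close> has right derivative \<open>1\<close>, hence \<open>\<phi> t \<le> t\<close>.\<close>

lemma le_of_equal_right_derivatives:
  fixes \<zeta>1 \<zeta>2 :: "real \<Rightarrow> real"
  assumes "0 \<le> T1" "0 \<le> T2"
    and cont: "continuous_on {0..T1} \<zeta>1" "continuous_on {0..T2} \<zeta>2"
    and mono: "strict_mono_on {0..T1} \<zeta>1" "strict_mono_on {0..T2} \<zeta>2"
    and init: "\<zeta>1 0 = \<zeta>2 0" and final: "\<zeta>1 T1 \<le> \<zeta>2 T2"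
    and deriv: "\<And>t s. \<lbrakk>t \<in> {0..<T1}; s \<in> {0..<T2}; \<zeta>1 t = \<zeta>2 s\<rbrakk> \<Longrightarrow>
      \<exists>b>0. \<forall>\<eta>>0. (\<forall>\<^sub>F h in at_right 0. \<zeta>1 (t + h) \<le> \<zeta>1 t + (b + \<eta>) * h)
        \<and> (\<forall>\<^sub>F h in at_right 0. \<zeta>2 (s + h) \<ge> \<zeta>2 s + (b - \<eta>) * h)"
    and t: "t \<in> {0..T1}" "t \<le> T2"
  shows "\<zeta>1 t \<le> \<zeta>2 t"
proof -
  have inj: "inj_on \<zeta>2 {0..T2}" using mono(2) by (rule strict_mono_on_imp_inj_on)
  have mono1: "\<zeta>1 a \<le> \<zeta>1 b" if "a \<in> {0..T1}" "b \<in> {0..T1}" "a \<le> b" for a b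
    using strict_mono_onD[OF mono(1) that(1,2)] that(3) by (cases "a = b") auto
  have le2: "a \<le> b" if "a \<in> {0..T2}" "b \<in> {0..T2}" "\<zeta>2 a \<le> \<zeta>2 b" for a b
    using strict_mono_onD[OF mono(2) that(2,1)] that(3) by (cases "a \<le> b") auto
  have mono2: "\<zeta>2 a \<le> \<zeta>2 b" if "a \<in> {0..T2}" "b \<in> {0..T2}" "a \<le> b" for a b
    using strict_mono_onD[OF mono(2) that(1,2)] that(3) by (cases "a = b") auto
  define \<phi> where "\<phi> = the_inv_into {0..T2} \<zeta>2 \<circ> \<zeta>1"
  have range: "\<zeta>1 s \<in> \<zeta>2 ` {0..T2}" if "s \<in> {0..T1}" for s
  proof -
    have "\<zeta>2 0 \<le> \<zeta>1 s" "\<zeta>1 s \<le> \<zeta>2 T2"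
      using mono1[of 0 s] mono1[of s T1] that init final by auto
    then obtain r where "0 \<le> r" "r \<le> T2" "\<zeta>2 r = \<zeta>1 s"
      using IVT'[of \<zeta>2 0 "\<zeta>1 s" T2] \<open>0 \<le> T2\<close> cont(2) by auto
    then show ?thesis by force
  qed
  have \<phi>: "\<phi> s \<in> {0..T2}" "\<zeta>2 (\<phi> s) = \<zeta>1 s" if "s \<in> {0..T1}" for s
    using the_inv_into_into[OF inj range[OF that] subset_refl] f_the_inv_into_f[OF inj range[OF that]]
    by (simp_all add: \<phi>_def)
  have \<phi>0: "\<phi> 0 = 0"
    using the_inv_into_f_f[OF inj, of 0] \<open>0 \<le> T2\<close> init by (simp add: \<phi>_def)
  have "continuous_on (\<zeta>2 ` {0..T2}) (the_inv_into {0..T2} \<zeta>2)"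
    by (rule continuous_on_inv[OF cont(2)]) (auto intro: the_inv_into_f_f[OF inj])
  then have cont\<phi>: "continuous_on {0..T1} \<phi>"
    unfolding \<phi>_def using range
    by (intro continuous_on_compose cont(1)) (auto intro: continuous_on_subset)
  have "\<phi> t \<le> t"
  proof (rule field_le_epsilon)
    fix e0 :: real assume "e0 > 0"
    define \<epsilon> where "\<epsilon> = e0 / (t + 1)"
    have \<epsilon>: "\<epsilon> > 0" using \<open>e0 > 0\<close> t by (simp add: \<epsilon>_def)
    have "(1 + \<epsilon>) * 0 - \<phi> 0 \<le> (1 + \<epsilon>) * t - \<phi> t"
    proof (rule continuous_le_from_right_steps[where F = "\<lambda>s. (1 + \<epsilon>) * s - \<phi> s"])
      show "0 \<le> t" using t by simp
      show "continuous_on {0..t} (\<lambda>s. (1 + \<epsilon>) * s - \<phi> s)"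
        using t by (intro continuous_intros continuous_on_subset[OF cont\<phi>]) auto
      fix s assume s: "s \<in> {0..<t}"
      have s1: "s \<in> {0..T1}" "s \<in> {0..<T1}" using s t by auto
      \<comment> \<open>\<open>deriv\<close> applies only before the right endpoints; strict
        monotonicity keeps \<open>\<phi> s\<close> away from \<open>T2\<close>.\<close>
      have "\<zeta>1 s < \<zeta>1 T1" using strict_mono_onD[OF mono(1), of s T1] s1 by auto
      then have "\<phi> s \<noteq> T2" using \<phi>(2)[OF s1(1)] final by auto
      then have s2: "\<phi> s \<in> {0..<T2}" using \<phi>(1)[OF s1(1)] by auto
      obtain b where b: "b > 0" and
        B: "\<And>\<eta>. \<eta> > 0 \<Longrightarrow> \<forall>\<^sub>F h in at_right 0. \<zeta>1 (s + h) \<le> \<zeta>1 s + (b + \<eta>) * h"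
           "\<And>\<eta>. \<eta> > 0 \<Longrightarrow> \<forall>\<^sub>F h in at_right 0. \<zeta>2 (\<phi> s + h) \<ge> \<zeta>2 (\<phi> s) + (b - \<eta>) * h"
        using deriv[OF s1(2) s2 \<phi>(2)[OF s1(1), symmetric]] by blast
      \<comment> \<open>The solution of \<open>b + \<eta> = (b - \<eta>) * (1 + \<epsilon>)\<close>:
        the rise of \<open>\<zeta>1\<close> in time \<open>h\<close> is then matched by
        \<open>\<zeta>2\<close> in time \<open>(1 + \<epsilon>) * h\<close>.\<close>
      define \<eta> where "\<eta> = \<epsilon> * b / (2 + \<epsilon>)"
      have \<eta>: "\<eta> > 0" using \<epsilon> b by (simp add: \<eta>_def)
      have "\<eta> * (2 + \<epsilon>) = \<epsilon> * b" using \<epsilon> by (simp add: \<eta>_def)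
      then have comp: "b + \<eta> = (b - \<eta>) * (1 + \<epsilon>)" by (simp add: algebra_simps)
      have lim: "filterlim (\<lambda>h. (1 + \<epsilon>) * h) (at_right 0) (at_right 0)"
        unfolding filterlim_at
      proof
        show "\<forall>\<^sub>F h in at_right 0. (1 + \<epsilon>) * h \<in> {0<..} \<and> (1 + \<epsilon>) * h \<noteq> 0"
          using eventually_at_right_less[of 0] \<epsilon> by (auto elim!: eventually_mono)
        show "((\<lambda>h. (1 + \<epsilon>) * h) \<longlongrightarrow> 0) (at_right 0)"
          by (auto intro!: tendsto_eq_intros)
      qed
      have "\<forall>\<^sub>F h in at_right 0. h \<in> {0<..<min (t - s) ((T2 - \<phi> s) / (1 + \<epsilon>))}"
        using s s2 \<epsilon> by (intro eventually_at_right_real) auto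
      with B(1)[OF \<eta>] eventually_compose_filterlim[OF B(2)[OF \<eta>] lim]
      have "\<forall>\<^sub>F h in at_right 0. h > 0 \<and> s + h \<le> t \<and>
          (1 + \<epsilon>) * s - \<phi> s \<le> (1 + \<epsilon>) * (s + h) - \<phi> (s + h)"
      proof eventually_elim
        case (elim h)
        have h: "h > 0" "s + h < t" "h < (T2 - \<phi> s) / (1 + \<epsilon>)" using elim(3) by auto
        have sh: "s + h \<in> {0..T1}" using h s t by auto
        have "(1 + \<epsilon>) * h \<le> T2 - \<phi> s" using h(3) \<epsilon> by (simp add: field_simps)
        then have r: "\<phi> s + (1 + \<epsilon>) * h \<in> {0..T2}" using s2 h \<epsilon> by auto
        have "\<zeta>1 (s + h) \<le> \<zeta>1 s + (b - \<eta>) * ((1 + \<epsilon>) * h)"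
          using elim(1) unfolding comp by (simp add: mult.assoc)
        also have "\<dots> \<le> \<zeta>2 (\<phi> s + (1 + \<epsilon>) * h)" using elim(2) \<phi>(2)[OF s1(1)] by simp
        finally have "\<zeta>2 (\<phi> (s + h)) \<le> \<zeta>2 (\<phi> s + (1 + \<epsilon>) * h)" using \<phi>(2)[OF sh] by simp
        then have "\<phi> (s + h) \<le> \<phi> s + (1 + \<epsilon>) * h" by (rule le2[OF \<phi>(1)[OF sh] r])
        then show ?case using h by (simp add: algebra_simps)
      qed
      then have "\<exists>h. h > 0 \<and> s + h \<le> t \<and>
          (1 + \<epsilon>) * s - \<phi> s \<le> (1 + \<epsilon>) * (s + h) - \<phi> (s + h)"
        using eventually_happens'[OF trivial_limit_at_right_real] by blast
      then show "\<exists>h>0. s + h \<le> t \<and> (1 + \<epsilon>) * s - \<phi> s \<le> (1 + \<epsilon>) * (s + h) - \<phi> (s + h)"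
        by simp
    qed
    then have "\<phi> t \<le> t + \<epsilon> * t" using \<phi>0 by (simp add: algebra_simps)
    moreover have "\<epsilon> * t \<le> \<epsilon> * (t + 1)" using \<epsilon> by simp
    moreover have "\<epsilon> * (t + 1) = e0" using t by (simp add: \<epsilon>_def)
    ultimately show "\<phi> t \<le> t + e0" by linarith
  qed
  then have "\<zeta>2 (\<phi> t) \<le> \<zeta>2 t" using \<phi>(1)[OF t(1)] t by (intro mono2) auto
  then show ?thesis using \<phi>(2)[OF t(1)] by simp
qed

section \<open>Comparison of two characteristics by height\<close>

context noncritical_singular_point
begin

lemma characteristic_height_right_derivative:
  assumes chr: "characteristic T \<xi> p" and t: "t \<in> {0..<T}" and "\<eta> > 0"
  shows "\<forall>\<^sub>F h in at_right 0. \<xi> (t + h) \<bullet> v0 \<le> \<xi> t \<bullet> v0 + (velocity (\<xi> t) \<bullet> v0 + \<eta>) * h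
    \<and> \<xi> (t + h) \<bullet> v0 \<ge> \<xi> t \<bullet> v0 + (velocity (\<xi> t) \<bullet> v0 - \<eta>) * h"
proof -
  have "\<eta> / norm v0 > 0" using \<open>\<eta> > 0\<close> v0 by simp
  from characteristic_right_derivative[OF chr _ _ this, of t] t
  obtain d where d: "d > 0" "\<And>s. \<lbrakk>s \<in> {t..T}; s \<le> t + d\<rbrakk> \<Longrightarrow>
      norm (\<xi> s - \<xi> t - (s - t) *\<^sub>R velocity (\<xi> t)) \<le> \<eta> / norm v0 * (s - t)" by auto
  show ?thesis unfolding eventually_at_right_field
  proof (intro exI[of _ "min d (T - t)"] conjI allI impI)
    fix h assume h: "0 < h" "h < min d (T - t)"
    let ?e = "\<xi> (t + h) - \<xi> t - h *\<^sub>R velocity (\<xi> t)"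
    have "norm ?e \<le> \<eta> / norm v0 * h" using d(2)[of "t + h"] h by simp
    then have "norm ?e * norm v0 \<le> \<eta> / norm v0 * h * norm v0" by (intro mult_right_mono) auto
    also have "\<dots> = \<eta> * h" using v0(2) by simp
    finally have "\<bar>?e \<bullet> v0\<bar> \<le> \<eta> * h" using Cauchy_Schwarz_ineq2[of ?e v0] by linarith
    moreover have "?e \<bullet> v0 = \<xi> (t + h) \<bullet> v0 - \<xi> t \<bullet> v0 - h * (velocity (\<xi> t) \<bullet> v0)"
      by (simp add: inner_diff_left)
    ultimately show "\<xi> (t + h) \<bullet> v0 \<le> \<xi> t \<bullet> v0 + (velocity (\<xi> t) \<bullet> v0 + \<eta>) * h"
      "\<xi> (t + h) \<bullet> v0 \<ge> \<xi> t \<bullet> v0 + (velocity (\<xi> t) \<bullet> v0 - \<eta>) * h"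
      by (auto simp: abs_le_iff algebra_simps)
  qed (use d t in auto)
qed

lemma characteristic_height_strict_mono:
  assumes chr: "characteristic T \<xi> p" and \<tau>: "\<tau> \<le> T"
    and pos: "\<And>t. t \<in> {0..\<tau>} \<Longrightarrow> velocity (\<xi> t) \<bullet> v0 > (norm v0)\<^sup>2 / 2"
  shows "strict_mono_on {0..\<tau>} (\<lambda>t. \<xi> t \<bullet> v0)"
proof (rule strict_mono_onI)
  fix a b assume ab: "a \<in> {0..\<tau>}" "b \<in> {0..\<tau>}" "a < b"
  \<comment> \<open>The height grows at a rate above \<open>2 * c\<close>; one \<open>c\<close> is
    spent on the derivative error, the other gives strictness.\<close>
  define c where "c = (norm v0)\<^sup>2 / 4"
  have c: "c > 0" using v0(2) by (simp add: c_def)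
  obtain L where L: "L-lipschitz_on {0..T} \<xi>" using chr unfolding characteristic_def by blast
  have "\<xi> a \<bullet> v0 - c * a \<le> \<xi> b \<bullet> v0 - c * b"
  proof (rule continuous_le_from_right_steps[where F = "\<lambda>t. \<xi> t \<bullet> v0 - c * t"])
    have "continuous_on {a..b} \<xi>"
      by (rule continuous_on_subset[OF lipschitz_on_continuous_on[OF L]]) (use ab \<tau> in auto)
    then show "continuous_on {a..b} (\<lambda>t. \<xi> t \<bullet> v0 - c * t)" by (intro continuous_intros)
    fix s assume s: "s \<in> {a..<b}"
    have "s \<in> {0..<T}" using s ab \<tau> by auto
    from characteristic_height_right_derivative[OF chr this c]
    have "\<forall>\<^sub>F h in at_right 0. \<xi> (s + h) \<bullet> v0 \<ge> \<xi> s \<bullet> v0 + (velocity (\<xi> s) \<bullet> v0 - c) * h"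
      by (auto elim!: eventually_mono)
    moreover have "\<forall>\<^sub>F h in at_right 0. h \<in> {0<..<b - s}" using s by (intro eventually_at_right_real) simp
    ultimately have "\<forall>\<^sub>F h in at_right 0. h > 0 \<and> s + h \<le> b \<and>
        \<xi> s \<bullet> v0 - c * s \<le> \<xi> (s + h) \<bullet> v0 - c * (s + h)"
    proof eventually_elim
      case (elim h)
      have "c * h \<le> (velocity (\<xi> s) \<bullet> v0 - c) * h"
        using pos[of s] s ab elim(2) by (intro mult_right_mono) (auto simp: c_def)
      then have "\<xi> (s + h) \<bullet> v0 \<ge> \<xi> s \<bullet> v0 + c * h" using elim(1) by linarith
      then show ?case using elim(2) by (simp add: distrib_left)
    qed
    then have "\<exists>h. h > 0 \<and> s + h \<le> b \<and> \<xi> s \<bullet> v0 - c * s \<le> \<xi> (s + h) \<bullet> v0 - c * (s + h)"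
      using eventually_happens'[OF trivial_limit_at_right_real] by blast
    then show "\<exists>h>0. s + h \<le> b \<and> \<xi> s \<bullet> v0 - c * s \<le> \<xi> (s + h) \<bullet> v0 - c * (s + h)" by simp
  qed (use ab in simp)
  moreover have "c * a < c * b" using c ab by simp
  ultimately show "\<xi> a \<bullet> v0 < \<xi> b \<bullet> v0" by linarith
qed

lemma characteristics_locally_unique:
  assumes chr1: "characteristic T \<xi>1 p1" "\<xi>1 0 = x0" and chr2: "characteristic T \<xi>2 p2" "\<xi>2 0 = x0"
    and T: "0 < T"
  shows "\<exists>\<tau>\<in>{0<..T}. \<forall>t\<in>{0..\<tau>}. \<xi>1 t = \<xi>2 t"
proof -
  obtain \<eta> where \<eta>: "\<eta> > 0" and
    window: "\<forall>T \<xi> p \<rho>. characteristic T \<xi> p \<longrightarrow> \<xi> 0 = x0 \<longrightarrow> 0 < T \<longrightarrow> \<rho> > 0 \<longrightarrow>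
     (\<exists>\<tau>\<in>{0<..T}. \<forall>t\<in>{0..\<tau>}. \<xi> t \<in> ball x0 \<rho> \<and> velocity (\<xi> t) \<bullet> v0 > (norm v0)\<^sup>2 / 2
        \<and> (t > 0 \<longrightarrow> spread \<eta> (\<xi> t)))"
    using characteristic_window by blast
  obtain r where r: "r > 0" "ball x0 r \<subseteq> \<Omega>" using ball_in_dom[OF x0] by blast
  \<comment> \<open>The second entry is the smallness required by
    \<open>spread_points_graph\<close>.\<close>
  define \<rho> where "\<rho> = min r (\<eta> / C)"
  have \<rho>: "\<rho> > 0" "ball x0 \<rho> \<subseteq> \<Omega>" using r \<eta> C_pos by (auto simp: \<rho>_def)
  have "C * \<rho> \<le> C * (\<eta> / C)" using C_pos by (intro mult_left_mono) (auto simp: \<rho>_def)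
  then have C\<rho>: "C * \<rho> \<le> \<eta>" using C_pos by simp
  obtain \<tau>1 where \<tau>1: "\<tau>1 \<in> {0<..T}" "\<And>t. t \<in> {0..\<tau>1} \<Longrightarrow> \<xi>1 t \<in> ball x0 \<rho> \<and>
      velocity (\<xi>1 t) \<bullet> v0 > (norm v0)\<^sup>2 / 2 \<and> (t > 0 \<longrightarrow> spread \<eta> (\<xi>1 t))"
    using window[rule_format, OF chr1 T \<rho>(1)] by blast
  obtain \<tau>2 where \<tau>2: "\<tau>2 \<in> {0<..T}" "\<And>t. t \<in> {0..\<tau>2} \<Longrightarrow> \<xi>2 t \<in> ball x0 \<rho> \<and>
      velocity (\<xi>2 t) \<bullet> v0 > (norm v0)\<^sup>2 / 2 \<and> (t > 0 \<longrightarrow> spread \<eta> (\<xi>2 t))"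
    using window[rule_format, OF chr2 T \<rho>(1)] by blast
  have sm: "strict_mono_on {0..\<tau>1} (\<lambda>t. \<xi>1 t \<bullet> v0)" "strict_mono_on {0..\<tau>2} (\<lambda>t. \<xi>2 t \<bullet> v0)"
    using \<tau>1 \<tau>2 by (auto intro!: characteristic_height_strict_mono[OF chr1(1)]
        characteristic_height_strict_mono[OF chr2(1)])
  have "continuous_on {0..T} \<xi>1" "continuous_on {0..T} \<xi>2"
    using chr1(1) chr2(1) lipschitz_on_continuous_on unfolding characteristic_def by blast+
  then have cont: "continuous_on {0..T} (\<lambda>t. \<xi>1 t \<bullet> v0)" "continuous_on {0..T} (\<lambda>t. \<xi>2 t \<bullet> v0)"
    by (auto intro!: continuous_intros)
  \<comment> \<open>Equal heights force equal positions, even at different times. Spread is known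
    only at positive times; if one time is 0, strict monotonicity makes the other 0 too.\<close>
  have meet: "\<xi>1 t = \<xi>2 s" if ts: "t \<in> {0..\<tau>1}" "s \<in> {0..\<tau>2}" "\<xi>1 t \<bullet> v0 = \<xi>2 s \<bullet> v0" for t s
  proof (cases "t = 0 \<or> s = 0")
    case True
    have "t = 0 \<and> s = 0"
    proof (rule ccontr)
      assume "\<not> (t = 0 \<and> s = 0)"
      then have "t = 0 \<and> s > 0 \<or> s = 0 \<and> t > 0" using True ts(1,2) by auto
      then consider "t = 0" "s > 0" | "s = 0" "t > 0" by blast
      then show False
      proof cases
        case 1
        then show False using strict_mono_onD[OF sm(2), of 0 s] ts chr1 chr2 by auto
      next
        case 2
        then show False using strict_mono_onD[OF sm(1), of 0 t] ts chr1 chr2 by auto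
      qed
    qed
    then show ?thesis using chr1 chr2 by simp
  next
    case False
    then have "spread \<eta> (\<xi>1 t)" "spread \<eta> (\<xi>2 s)" using \<tau>1(2)[of t] \<tau>2(2)[of s] ts by auto
    then show ?thesis
      using \<tau>1(2)[of t] \<tau>2(2)[of s] ts by (intro spread_points_graph[OF \<rho>(2) C\<rho> \<eta>]) auto
  qed
  have bound: "\<exists>\<tau>\<in>{0<..\<tau>1'}. \<forall>t\<in>{0..\<tau>}. f t \<le> z"
    if f: "continuous_on {0..T} f" "f 0 < z" "\<tau>1' \<in> {0<..T}" for f :: "real \<Rightarrow> real" and z \<tau>1'
  proof -
    obtain d where d: "d > 0" "\<forall>t\<in>{0..T}. dist t 0 < d \<longrightarrow> dist (f t) (f 0) < z - f 0"
      using f(1)[unfolded continuous_on_iff, rule_format, of 0 "z - f 0"] f(2) T by auto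
    have "f t \<le> z" if "t \<in> {0..min \<tau>1' (d/2)}" for t
    proof -
      have "t \<in> {0..T}" "dist t 0 < d" using d(1) that f(3) by (auto simp: dist_real_def)
      then have "\<bar>f t - f 0\<bar> < z - f 0" using d(2) by (simp add: dist_real_def)
      then show ?thesis by linarith
    qed
    then show ?thesis using d(1) f(3) by (intro bexI[of _ "min \<tau>1' (d/2)"]) auto
  qed
  have "\<xi>1 0 \<bullet> v0 < \<xi>2 \<tau>2 \<bullet> v0" "\<xi>2 0 \<bullet> v0 < \<xi>1 \<tau>1 \<bullet> v0"
    using strict_mono_onD[OF sm(1), of 0 \<tau>1] strict_mono_onD[OF sm(2), of 0 \<tau>2] \<tau>1(1) \<tau>2(1)
      chr1(2) chr2(2) by auto
  \<comment> \<open>Each curve is shortened until its heights lie in the range of the other on its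
    whole window, so that the reparametrization is defined in both directions.\<close>
  with bound[OF cont(1) _ \<tau>1(1)] bound[OF cont(2) _ \<tau>2(1)]
  obtain \<tau>1' \<tau>2' where \<tau>1': "\<tau>1' \<in> {0<..\<tau>1}" "\<xi>1 \<tau>1' \<bullet> v0 \<le> \<xi>2 \<tau>2 \<bullet> v0"
    and \<tau>2': "\<tau>2' \<in> {0<..\<tau>2}" "\<xi>2 \<tau>2' \<bullet> v0 \<le> \<xi>1 \<tau>1 \<bullet> v0"
    by (metis atLeastAtMost_iff greaterThanAtMost_iff less_eq_real_def)
  \<comment> \<open>One slope \<open>b\<close> serves both curves because \<open>velocity\<close>
    depends on the position alone.\<close>
  have deriv: "\<exists>b>0. \<forall>\<eta>>0. (\<forall>\<^sub>F h in at_right 0. \<xi> (t + h) \<bullet> v0 \<le> \<xi> t \<bullet> v0 + (b + \<eta>) * h)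
        \<and> (\<forall>\<^sub>F h in at_right 0. \<xi>' (s + h) \<bullet> v0 \<ge> \<xi>' s \<bullet> v0 + (b - \<eta>) * h)"
    if "characteristic T \<xi> p" "characteristic T \<xi>' p'" "t \<in> {0..<T}" "s \<in> {0..<T}"
      "\<xi> t = \<xi>' s" "velocity (\<xi> t) \<bullet> v0 > (norm v0)\<^sup>2 / 2" for \<xi> \<xi>' p p' t s
  proof (intro exI[of _ "velocity (\<xi> t) \<bullet> v0"] conjI allI impI)
    show "velocity (\<xi> t) \<bullet> v0 > 0" using that(6) v0(2) by (meson half_gt_zero less_trans zero_less_power)
    fix \<eta> :: real assume "\<eta> > 0"
    show "\<forall>\<^sub>F h in at_right 0. \<xi> (t + h) \<bullet> v0 \<le> \<xi> t \<bullet> v0 + (velocity (\<xi> t) \<bullet> v0 + \<eta>) * h"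
      using characteristic_height_right_derivative[OF that(1,3) \<open>\<eta> > 0\<close>] by (auto elim: eventually_mono)
    show "\<forall>\<^sub>F h in at_right 0. \<xi>' (s + h) \<bullet> v0 \<ge> \<xi>' s \<bullet> v0 + (velocity (\<xi> t) \<bullet> v0 - \<eta>) * h"
      using characteristic_height_right_derivative[OF that(2,4) \<open>\<eta> > 0\<close>] unfolding that(5)
      by (auto elim: eventually_mono)
  qed
  define \<tau> where "\<tau> = min \<tau>1' \<tau>2'"
  have \<tau>: "\<tau> \<in> {0<..T}" "\<tau> \<le> \<tau>1'" "\<tau> \<le> \<tau>2'" using \<tau>1' \<tau>2' \<tau>1(1) by (auto simp: \<tau>_def)
  show ?thesis
  proof (intro bexI[OF _ \<tau>(1)] ballI)
    fix t assume t: "t \<in> {0..\<tau>}"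
    have "\<xi>1 t \<bullet> v0 \<le> \<xi>2 t \<bullet> v0"
    proof (rule le_of_equal_right_derivatives[where ?T1.0 = \<tau>1' and ?T2.0 = \<tau>2
          and ?\<zeta>1.0 = "\<lambda>t. \<xi>1 t \<bullet> v0" and ?\<zeta>2.0 = "\<lambda>t. \<xi>2 t \<bullet> v0"])
      show "strict_mono_on {0..\<tau>1'} (\<lambda>t. \<xi>1 t \<bullet> v0)"
        by (rule monotone_on_subset[OF sm(1)]) (use \<tau>1' in auto)
      fix a b assume ab: "a \<in> {0..<\<tau>1'}" "b \<in> {0..<\<tau>2}" "\<xi>1 a \<bullet> v0 = \<xi>2 b \<bullet> v0"
      show "\<exists>c>0. \<forall>\<eta>>0. (\<forall>\<^sub>F h in at_right 0. \<xi>1 (a + h) \<bullet> v0 \<le> \<xi>1 a \<bullet> v0 + (c + \<eta>) * h)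
        \<and> (\<forall>\<^sub>F h in at_right 0. \<xi>2 (b + h) \<bullet> v0 \<ge> \<xi>2 b \<bullet> v0 + (c - \<eta>) * h)"
        using ab \<tau>1' \<tau>1 \<tau>2 by (intro deriv[OF chr1(1) chr2(1)] meet) auto
    qed (use \<tau> \<tau>1' \<tau>2' \<tau>1(1) \<tau>2(1) t sm chr1(2) chr2(2)
        continuous_on_subset[OF cont(1)] continuous_on_subset[OF cont(2)] in auto)
    moreover have "\<xi>2 t \<bullet> v0 \<le> \<xi>1 t \<bullet> v0"
    proof (rule le_of_equal_right_derivatives[where ?T1.0 = \<tau>2' and ?T2.0 = \<tau>1
          and ?\<zeta>1.0 = "\<lambda>t. \<xi>2 t \<bullet> v0" and ?\<zeta>2.0 = "\<lambda>t. \<xi>1 t \<bullet> v0"])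
      show "strict_mono_on {0..\<tau>2'} (\<lambda>t. \<xi>2 t \<bullet> v0)"
        by (rule monotone_on_subset[OF sm(2)]) (use \<tau>2' in auto)
      fix a b assume ab: "a \<in> {0..<\<tau>2'}" "b \<in> {0..<\<tau>1}" "\<xi>2 a \<bullet> v0 = \<xi>1 b \<bullet> v0"
      show "\<exists>c>0. \<forall>\<eta>>0. (\<forall>\<^sub>F h in at_right 0. \<xi>2 (a + h) \<bullet> v0 \<le> \<xi>2 a \<bullet> v0 + (c + \<eta>) * h)
        \<and> (\<forall>\<^sub>F h in at_right 0. \<xi>1 (b + h) \<bullet> v0 \<ge> \<xi>1 b \<bullet> v0 + (c - \<eta>) * h)"
        using ab \<tau>2' \<tau>1 \<tau>2 by (intro deriv[OF chr2(1) chr1(1)] meet[symmetric]) auto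
    qed (use \<tau> \<tau>1' \<tau>2' \<tau>1(1) \<tau>2(1) t sm chr1(2) chr2(2)
        continuous_on_subset[OF cont(1)] continuous_on_subset[OF cont(2)] in auto)
    ultimately show "\<xi>1 t = \<xi>2 t" using t \<tau> \<tau>1' \<tau>2' by (intro meet) auto
  qed
qed

end

section \<open>Reduction of the planar theorem to the abstract setting\<close>

lemma (in semiconcave_viscosity_solution) strict_singular_characteristic_imp_characteristic:
  assumes "strict_singular_characteristic \<Omega> H u x0 T \<xi>"
  obtains p where "characteristic T \<xi> p"
proof -
  obtain L p where L: "L-lipschitz_on {0..T} \<xi>" and sing: "\<forall>t\<in>{0..T}. \<xi> t \<in> Sing \<Omega> u"
    and p: "\<forall>t\<in>{0..T}. p t \<in> D (\<xi> t)"
    and ae: "AE t in lebesgue_on {0..T}.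
      (\<xi> has_vector_derivative H_p H (\<xi> t) (p t)) (at t within {0..T})"
    using assms unfolding strict_singular_characteristic_def by blast
  \<comment> \<open>The almost-everywhere clause is turned into an explicit null set, the form in
    which \<open>nondecreasing_from_left_Dini_ae\<close> takes its exceptional set.\<close>
  have "AE t in lebesgue. t \<in> {0..T} \<longrightarrow>
      (\<xi> has_vector_derivative H_p H (\<xi> t) (p t)) (at t within {0..T})"
    using ae by (subst (asm) AE_restrict_space_iff) auto
  then obtain N where "N \<in> null_sets lebesgue" "{t \<in> space lebesgue. \<not> (t \<in> {0..T} \<longrightarrow>
      (\<xi> has_vector_derivative H_p H (\<xi> t) (p t)) (at t within {0..T}))} \<subseteq> N"
    unfolding eventually_ae_filter by blast
  then have "\<exists>N\<in>null_sets lebesgue. \<forall>t\<in>{0..T} - N.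
      (\<xi> has_vector_derivative H_p H (\<xi> t) (p t)) (at t within {0..T})"
    by (intro bexI[of _ N]) auto
  then have "characteristic T \<xi> p"
    unfolding characteristic_def using L sing p unfolding Sing_def by blast
  then show ?thesis by (rule that)
qed

text \<open>\<open>n\<close> is the normalized rotation of \<open>v\<close> by a right angle, so the
  last identity is the expansion in an orthogonal basis.\<close>

lemma plane_decomposition:
  fixes v n :: "real^2"
  assumes "v \<noteq> 0" and n: "n = (1 / norm v) *\<^sub>R vector [- (v $ 2), v $ 1]"
  shows "norm n = 1" "v \<bullet> n = 0" "w = (w \<bullet> n) *\<^sub>R n + (w \<bullet> v / (norm v)\<^sup>2) *\<^sub>R v"
proof -
  have nv: "norm v > 0" using assms(1) by simp
  have sq: "(norm v)\<^sup>2 = (v $ 1)\<^sup>2 + (v $ 2)\<^sup>2"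
    unfolding power2_norm_eq_inner by (simp add: inner_vec_def sum_2 power2_eq_square)
  let ?m = "vector [- (v $ 2), v $ 1] :: real^2"
  have "?m \<bullet> ?m = (norm v)\<^sup>2" unfolding sq by (simp add: inner_vec_def sum_2 power2_eq_square)
  then have "n \<bullet> n = 1" using nv by (simp add: n power2_eq_square)
  then show "norm n = 1" by (simp add: norm_eq_sqrt_inner)
  show "v \<bullet> n = 0" by (simp add: n inner_vec_def sum_2)
  have "w \<bullet> n = (w $ 2 * v $ 1 - w $ 1 * v $ 2) / norm v"
    by (simp add: n inner_vec_def sum_2 diff_divide_distrib)
  then have "(w \<bullet> n) *\<^sub>R n = ((w $ 2 * v $ 1 - w $ 1 * v $ 2) / (norm v)\<^sup>2) *\<^sub>R ?m"
    by (simp add: n power2_eq_square)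
  \<comment> \<open>Multiplication by the squared norm clears the denominators and leaves a
    polynomial identity in the coordinates.\<close>
  then have "(norm v)\<^sup>2 *\<^sub>R ((w \<bullet> n) *\<^sub>R n + (w \<bullet> v / (norm v)\<^sup>2) *\<^sub>R v)
      = (w $ 2 * v $ 1 - w $ 1 * v $ 2) *\<^sub>R ?m + (w \<bullet> v) *\<^sub>R v"
    using nv by (simp only: scaleR_add_right scaleR_scaleR) simp
  also have "\<dots> = (norm v)\<^sup>2 *\<^sub>R w"
    unfolding sq vec_eq_iff forall_2 by (simp add: inner_vec_def sum_2 algebra_simps power2_eq_square)
  finally have "(norm v)\<^sup>2 *\<^sub>R ((w \<bullet> n) *\<^sub>R n + (w \<bullet> v / (norm v)\<^sup>2) *\<^sub>R v) = (norm v)\<^sup>2 *\<^sub>R w" .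
  then show "w = (w \<bullet> n) *\<^sub>R n + (w \<bullet> v / (norm v)\<^sup>2) *\<^sub>R v" using nv by simp
qed

theorem theorem3p9:
  fixes \<Omega> :: "(real^2) set"
    and H :: "real^2 \<Rightarrow> real^2 \<Rightarrow> real"
    and u :: "real^2 \<Rightarrow> real"
    and x\<^sub>0 :: "real^2"
    and T :: real
    and x\<^sub>1 x\<^sub>2 :: "real \<Rightarrow> real^2"
  assumes "open \<Omega>" and "connected \<Omega>" and "bounded \<Omega>"
    and "C1_on (\<Omega> \<times> UNIV) (\<lambda>(x, p). H x p)"
    and "\<And>x. x \<in> \<Omega> \<Longrightarrow> strictly_convex_on UNIV (H x)"
    and "semiconcave_on \<Omega> u"
    and "viscosity_solution \<Omega> H u"
    and "x\<^sub>0 \<in> Sing \<Omega> u"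
    and "0 \<notin> H_p H x\<^sub>0 ` superdiff \<Omega> u x\<^sub>0"
    and "strict_singular_characteristic \<Omega> H u x\<^sub>0 T x\<^sub>1"
    and "strict_singular_characteristic \<Omega> H u x\<^sub>0 T x\<^sub>2"
  shows "\<exists>\<tau>\<in>{0<..T}. \<forall>t\<in>{0..\<tau>}. x\<^sub>1 t = x\<^sub>2 t"
proof -
  obtain C where C: "C > 0" "\<And>c x y. \<lbrakk>c \<in> {0..1}; x \<in> \<Omega>; y \<in> \<Omega>; closed_segment x y \<subseteq> \<Omega>\<rbrakk> \<Longrightarrow>
     c * u x + (1 - c) * u y - u (c *\<^sub>R x + (1 - c) *\<^sub>R y) \<le> C / 2 * c * (1 - c) * (norm (x - y))\<^sup>2"
    using assms(6) unfolding semiconcave_on_def by blast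
  interpret semiconcave_viscosity_solution \<Omega> u C H
  proof
    show "continuous_on \<Omega> u" using assms(7) unfolding viscosity_solution_def by blast
  qed (fact assms C)+
  have x0: "x\<^sub>0 \<in> \<Omega>" using assms(8) by (simp add: Sing_def)
  have ne: "velocity x\<^sub>0 \<noteq> 0" using assms(9) min_momentum_in[OF x0] by force
  \<comment> \<open>\<open>Sing\<close> by itself only denies that the superdifferential is a
    singleton; that it is nonempty comes from \<open>min_momentum_in\<close>.\<close>
  have sing: "\<exists>q\<in>D x\<^sub>0. q \<noteq> min_momentum x\<^sub>0"
    using assms(8) min_momentum_in[OF x0] unfolding Sing_def is_singleton_def by blast
  define n where "n = (1 / norm (velocity x\<^sub>0)) *\<^sub>R (vector [- (velocity x\<^sub>0 $ 2), velocity x\<^sub>0 $ 1] :: real^2)"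
  interpret noncritical_singular_point \<Omega> u C H x\<^sub>0 n
    by unfold_locales (fact x0 sing ne plane_decomposition[OF ne n_def])+
  obtain p1 p2 where "characteristic T x\<^sub>1 p1" "characteristic T x\<^sub>2 p2"
    using strict_singular_characteristic_imp_characteristic assms(10,11) by metis
  then show ?thesis
    using assms(10,11) unfolding strict_singular_characteristic_def
    by (intro characteristics_locally_unique) auto
qed

end
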